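(* Let $A\in\mathbb{R}^{m\times n}$ have rank $\rho$, let $1\le k<\rho$ be a target rank, and let $\ell>k$ be an integer. Fix an SVD of $A$, with associated leverage scores $s_1^*,\ldots,s_n^*$ relative to rank $k$. Let $\mathbf{s}=(s_1,\ldots,s_n)$ be admissible sampling scores (so $\sum_{i=1}^n s_i=k$), and let $C\in\mathbb{R}^{m\times \ell}$ be the random matrix whose columns are $\ell$ columns of $A$ drawn independently with replacement, the $i$-th column being chosen in each draw with probability $s_i/k$. Let $\delta\in(0,1)$. Then, with probability at least $1-\delta-2k\exp\left(-\ell/[8k\,c(\mathbf{s})]\right)$, $$\|A-P_CA\|_2\le \sigma_{k+1}\,(1+\epsilon(\mathbf{s})),$$ where $$\epsilon(\mathbf{s})=3\left[\sqrt{c(\mathbf{s})\,\frac{k(\rho+1-k)\log(\rho/\delta)}{\ell}}+q(\mathbf{s})\,\frac{k\log(\rho/\delta)}{\ell}\right]$$ and $\sigma_{k+1}=\|A-A_k\|_2$ is the $(k+1)$-th largest singular value of $A$, $A_k$ being the best rank-$k$ approximation of $A$.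
   Context: SVD: write $A=U\begin{pmatrix}\Sigma_1 & 0 \\ 0 & \Sigma_2\end{pmatrix}\begin{pmatrix} V_1^\top \\ V_2^\top \end{pmatrix}$, a thin SVD with singular values in descending order, where $\Sigma_1\in\mathbb{R}^{k\times k}$, $\Sigma_2\in\mathbb{R}^{(\rho-k)\times(\rho-k)}$, $V_1\in\mathbb{R}^{n\times k}$, $V_2\in\mathbb{R}^{n\times(\rho-k)}$, and $U$, $(V_1, V_2)$ have orthonormal columns. Leverage scores: write $V_1^\top=(\mathbf{v}_1,\ldots,\mathbf{v}_n)\in\mathbb{R}^{k\times n}$. The statistical leverage scores of $A$ relative to rank $k$ are $s_i^*=\|\mathbf{v}_i\|_2^2$; they satisfy $\sum_{i=1}^n s_i^*=k$. Admissible sampling scores: $\mathbf{s}=(s_1,\ldots,s_n)$ with $s_i\ge 0$, $\sum_{i=1}^n s_i=k$, and $s_i>0$ whenever $s_i^*>0$. Quantities (with the convention $0/0=0$): $c(\mathbf{s})=\max_{1\le i\le n}\frac{s_i^*}{s_i}$ and $q(\mathbf{s})=\max_{1\le i\le n}\frac{\sqrt{s_i^*}}{s_i}$. $P_C=CC^\dagger$ is the orthogonal projection onto the column space of $C$ ($C^\dagger$ is the pseudoinverse), and $\|\cdot\|_2$ is the spectral norm. *)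

theory Defs
  imports "HOL-Probability.Probability"
begin

definition spectral_norm :: "real^'n^'m \<Rightarrow> real" where
  "spectral_norm A = onorm ((*v) A)"

text \<open>
  The four Penrose equations, which determine the Moore-Penrose inverse uniquely.
\<close>

definition is_pinv :: "real^'n^'m \<Rightarrow> real^'m^'n \<Rightarrow> bool" where
  "is_pinv C X \<longleftrightarrow>
     C ** X ** C = C \<and> X ** C ** X = X \<and>
     transpose (C ** X) = C ** X \<and> transpose (X ** C) = X ** C"

definition pinv :: "real^'n^'m \<Rightarrow> real^'m^'n" where
  "pinv C = (THE X. is_pinv C X)"

definition col_proj :: "real^'n^'m \<Rightarrow> real^'m^'m" where
  "col_proj C = C ** pinv C"

text \<open>
  The columns of the factors of a thin singular value decomposition form sequences
  \<open>u\<close>, \<open>v\<close> and the singular values a sequence \<open>\<sigma>\<close>, all indexed from 0.  Only the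
  entries with index below the inner dimension matter, and \<open>\<sigma> k\<close> is the \<open>(k + 1)\<close>-th
  largest singular value.  The matrix
  \<open>svd_mat r \<sigma> u v\<close> is the product of the matrix with columns \<open>u 0, ..., u (r - 1)\<close>, the
  diagonal matrix with entries \<open>\<sigma> 0, ..., \<sigma> (r - 1)\<close>, and the transpose of the matrix with
  columns \<open>v 0, ..., v (r - 1)\<close>.
\<close>

definition svd_mat ::
  "nat \<Rightarrow> (nat \<Rightarrow> real) \<Rightarrow> (nat \<Rightarrow> real^'m) \<Rightarrow> (nat \<Rightarrow> real^'n) \<Rightarrow> real^'n^'m" where
  "svd_mat r \<sigma> u v = (\<chi> i j. \<Sum>t<r. u t $ i * \<sigma> t * v t $ j)"

definition orthonormal_upto :: "nat \<Rightarrow> (nat \<Rightarrow> real^'n) \<Rightarrow> bool" where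
  "orthonormal_upto r w \<longleftrightarrow> (\<forall>a<r. \<forall>b<r. w a \<bullet> w b = (if a = b then 1 else 0))"

text \<open>
  For inner dimension equal to the rank of \<open>A\<close>, all the singular values below are
  automatically positive.
\<close>

definition thin_svd ::
  "real^'n^'m \<Rightarrow> nat \<Rightarrow> (nat \<Rightarrow> real) \<Rightarrow> (nat \<Rightarrow> real^'m) \<Rightarrow> (nat \<Rightarrow> real^'n) \<Rightarrow> bool" where
  "thin_svd A r \<sigma> u v \<longleftrightarrow>
     orthonormal_upto r u \<and> orthonormal_upto r v \<and>
     (\<forall>a<r. 0 \<le> \<sigma> a) \<and> (\<forall>a b. a \<le> b \<and> b < r \<longrightarrow> \<sigma> b \<le> \<sigma> a) \<and>
     A = svd_mat r \<sigma> u v"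

definition best_rank_approx :: "nat \<Rightarrow> real^'n^'m \<Rightarrow> real^'n^'m \<Rightarrow> bool" where
  "best_rank_approx k A B \<longleftrightarrow>
     rank B \<le> k \<and>
     (\<forall>B'. rank B' \<le> k \<longrightarrow> spectral_norm (A - B) \<le> spectral_norm (A - B'))"

text \<open>
  Squared Euclidean norm of the \<open>i\<close>-th row of the matrix with columns
  \<open>v 0, ..., v (k - 1)\<close>.
\<close>

definition leverage :: "nat \<Rightarrow> (nat \<Rightarrow> real^'n) \<Rightarrow> 'n \<Rightarrow> real" where
  "leverage k v i = (\<Sum>t<k. (v t $ i)\<^sup>2)"

definition admissible :: "nat \<Rightarrow> ('n::finite \<Rightarrow> real) \<Rightarrow> ('n \<Rightarrow> real) \<Rightarrow> bool" where
  "admissible k lev s \<longleftrightarrow>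
     (\<forall>i. 0 \<le> s i) \<and> (\<Sum>i\<in>UNIV. s i) = real k \<and> (\<forall>i. 0 < lev i \<longrightarrow> 0 < s i)"

text \<open>
  In both maxima the library convention \<open>x / 0 = 0\<close> only acts as \<open>0 / 0 = 0\<close> when \<open>s\<close>
  is admissible, since then \<open>s i = 0\<close> forces \<open>lev i = 0\<close> for a leverage score.
\<close>

definition score_c :: "('n::finite \<Rightarrow> real) \<Rightarrow> ('n \<Rightarrow> real) \<Rightarrow> real" where
  "score_c lev s = Max (range (\<lambda>i. lev i / s i))"

definition score_q :: "('n::finite \<Rightarrow> real) \<Rightarrow> ('n \<Rightarrow> real) \<Rightarrow> real" where
  "score_q lev s = Max (range (\<lambda>i. sqrt (lev i) / s i))"

definition score_eps ::
  "nat \<Rightarrow> nat \<Rightarrow> nat \<Rightarrow> real \<Rightarrow> ('n::finite \<Rightarrow> real) \<Rightarrow> ('n \<Rightarrow> real) \<Rightarrow> real" where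
  "score_eps k \<rho> l \<delta> lev s =
     3 * (sqrt (score_c lev s * (real k * (real \<rho> + 1 - real k) * ln (real \<rho> / \<delta>) / real l))
          + score_q lev s * (real k * ln (real \<rho> / \<delta>) / real l))"

definition col_select :: "real^'n^'m \<Rightarrow> ('l \<Rightarrow> 'n) \<Rightarrow> real^'l^'m" where
  "col_select A f = (\<chi> i t. A $ i $ f t)"

end

theory Submission
  imports Defs
begin

text \<open>
  Let \<open>P\<close> and \<open>Q\<close> be the orthogonal projections onto the spans of the first \<open>k\<close> and of the
  remaining right singular vectors, \<open>y\<^sub>i = P e\<^sub>i\<close>, \<open>w\<^sub>i = Q e\<^sub>i\<close>, and let \<open>G\<close> and \<open>S\<close> be the sums of
  \<open>k / (\<ell> s\<^sub>i) y\<^sub>i y\<^sub>i\<^sup>T\<close> and \<open>k / (\<ell> s\<^sub>i) w\<^sub>i y\<^sub>i\<^sup>T\<close> over the sampled indices \<open>i\<close>; their means are \<open>P\<close>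
  and \<open>Q P = 0\<close>.  If \<open>G \<ge> 1/2\<close> on the range of \<open>P\<close>, comparing the projection \<open>P\<^sub>C A\<close> with a
  suitable \<open>C X\<close> gives \<open>\<parallel>A - P\<^sub>C A\<parallel> \<le> \<sigma>\<^sub>k\<^sub>+\<^sub>1 (1 + 2 \<parallel>S\<parallel>)\<close>.

  The variance proxy in the theorem dominates the second moment of \<open>S\<close> in the Frobenius norm, so
  \<open>S\<close> is controlled by Pinelis' dimension-free Bernstein inequality for sums of random vectors,
  based on the submartingale \<open>cosh (\<lambda> \<parallel>z\<parallel>)\<close>; its prefactor 2 is at most \<open>\<rho>\<close>.

  The lower tail of \<open>G\<close> needs a matrix Chernoff bound.  The draws being identically distributed, the
  Golden-Thompson inequality is enough, and the exponential is replaced by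
  \<open>(P - G / N)\<^sup>N\<close> with \<open>N = 2\<^sup>n\<close>, \<open>n \<rightarrow> \<infinity>\<close>: the inequality
  \<open>tr (X Y)\<^sup>N \<le> tr (X\<^sup>N Y\<^sup>N)\<close> for symmetric \<open>X\<close>, \<open>Y\<close> only uses Cauchy-Schwarz, and for the rank-one
  summands the power is explicit, so that no spectral theorem is required.
\<close>

section \<open>Matrix algebra and a trace inequality\<close>

text \<open>Bounded bilinearity supplies, through the interpretations \<open>matmul\<close> and
  \<open>matvec\<close>, the rules for sums, differences and scalar factors in either
  argument.\<close>

lemma bounded_bilinear_matrix_matrix_mult:
  "bounded_bilinear ((**) :: real^'n^'m \<Rightarrow> real^'p^'n \<Rightarrow> real^'p^'m)"
  unfolding bilinear_conv_bounded_bilinear [symmetric] bilinear_def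
  by (auto intro!: linearI simp: matrix_matrix_mult_def vec_eq_iff sum.distrib sum_distrib_left
      algebra_simps)

interpretation matmul: bounded_bilinear "(**) :: real^'n^'m \<Rightarrow> real^'p^'n \<Rightarrow> real^'p^'m"
  by (rule bounded_bilinear_matrix_matrix_mult)

lemma bounded_bilinear_matrix_vector_mult:
  "bounded_bilinear ((*v) :: real^'n^'m \<Rightarrow> real^'n \<Rightarrow> real^'m)"
  unfolding bilinear_conv_bounded_bilinear [symmetric] bilinear_def
  by (auto intro!: linearI simp: matrix_vector_mult_def vec_eq_iff sum.distrib sum_distrib_left
      algebra_simps)

interpretation matvec: bounded_bilinear "(*v) :: real^'n^'m \<Rightarrow> real^'n \<Rightarrow> real^'m"
  by (rule bounded_bilinear_matrix_vector_mult)

lemma inner_matrix_vector_left: "(A *v x) \<bullet> y = x \<bullet> (transpose A *v y)"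
  for A :: "real^'n^'m"
  by (metis dot_lmul_matrix inner_commute transpose_matrix_vector)

lemma inner_symmetric_matrix:
  "transpose A = A \<Longrightarrow> (A *v x) \<bullet> y = x \<bullet> (A *v y)" for A :: "real^'n^'n"
  by (simp add: inner_matrix_vector_left del: transpose_matrix_vector)

lemma transpose_add: "transpose (A + B) = transpose A + transpose B" for A B :: "real^'n^'m"
  by (simp add: transpose_def vec_eq_iff)

lemma transpose_diff: "transpose (A - B) = transpose A - transpose B" for A B :: "real^'n^'m"
  by (simp add: transpose_def vec_eq_iff)

lemma transpose_zero [simp]: "transpose 0 = (0 :: real^'n^'m)"
  by (simp add: transpose_def vec_eq_iff)

lemma trace_scaleR: "trace (c *\<^sub>R A) = c * trace A" for A :: "real^'n^'n"
  by (simp add: trace_def sum_distrib_left)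

text \<open>The library inner product on matrices is the entrywise one, so \<open>norm\<close> of a
  matrix is its Frobenius norm; traces of products thereby become subject to Cauchy-Schwarz.\<close>

lemma trace_transpose_mult: "trace (transpose A ** B) = A \<bullet> B" for A B :: "real^'n^'m"
  unfolding trace_def matrix_matrix_mult_def transpose_def inner_vec_def
  by (simp, subst sum.swap, simp)

lemma trace_mult_le: "\<bar>trace (transpose A ** B)\<bar> \<le> norm A * norm B" for A B :: "real^'n^'m"
  by (simp add: trace_transpose_mult Cauchy_Schwarz_ineq2)

lemma norm_matrix_square: "(norm A)\<^sup>2 = trace (transpose A ** A)" for A :: "real^'n^'m"
  by (simp add: trace_transpose_mult power2_norm_eq_inner)

text \<open>Cauchy-Schwarz in each row: the Frobenius norm dominates the operator norm.\<close>

lemma norm_matrix_vector_mult_le: "norm (A *v x) \<le> norm A * norm x" for A :: "real^'n^'m"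
proof -
  have "(norm (A *v x))\<^sup>2 = (\<Sum>i\<in>UNIV. (A $ i \<bullet> x)\<^sup>2)"
    by (simp add: norm_vec_def L2_set_def sum_nonneg matrix_mult_dot)
  also have "\<dots> \<le> (\<Sum>i\<in>UNIV. (norm (A $ i))\<^sup>2 * (norm x)\<^sup>2)"
    by (intro sum_mono) (simp add: Cauchy_Schwarz_ineq power2_norm_eq_inner)
  also have "\<dots> = (norm A * norm x)\<^sup>2"
    by (simp add: sum_distrib_right [symmetric] power_mult_distrib norm_vec_def[of A] L2_set_def sum_nonneg)
  finally show ?thesis
    by (rule power2_le_imp_le) simp
qed

definition outer :: "real^'m \<Rightarrow> real^'n \<Rightarrow> real^'n^'m" where
  "outer x y = (\<chi> i j. x $ i * y $ j)"

lemma outer_mult_vector: "outer x y *v z = (y \<bullet> z) *\<^sub>R x"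
  by (simp add: outer_def matrix_vector_mult_def vec_eq_iff inner_vec_def sum_distrib_left mult_ac)

lemma mult_outer: "A ** outer x y = outer (A *v x) y"
  by (simp add: outer_def matrix_matrix_mult_def matrix_vector_mult_def vec_eq_iff
      sum_distrib_left mult_ac)

lemma transpose_outer: "transpose (outer x y) = outer y x"
  by (simp add: outer_def transpose_def mult.commute)

lemma outer_mult: "outer x y ** A = outer x (transpose A *v y)"
  by (metis matrix_transpose_mul mult_outer transpose_outer transpose_transpose)

lemma outer_scaleR_left: "outer (c *\<^sub>R x) y = c *\<^sub>R outer x y"
  by (simp add: outer_def vec_eq_iff)

lemma trace_outer: "trace (outer x y) = x \<bullet> y"
  by (simp add: outer_def trace_def inner_vec_def)

lemma norm_outer: "norm (outer x y) = norm x * norm y"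
proof -
  have "(norm (outer x y))\<^sup>2 = trace (outer ((y \<bullet> y) *\<^sub>R x) x)"
    unfolding norm_matrix_square trace_mul_sym[of "transpose (outer x y)"]
    by (simp add: transpose_outer mult_outer outer_mult_vector)
  also have "\<dots> = (norm x * norm y)\<^sup>2"
    by (simp add: trace_outer power_mult_distrib power2_norm_eq_inner)
  finally show ?thesis
    by (simp add: power2_eq_iff_nonneg)
qed

text \<open>
  \<open>pow2 n A\<close> is the matrix power with exponent \<open>2 ^ n\<close>; the library's \<open>^\<close> on \<open>real^'n^'n\<close> would be
  the entrywise power.
\<close>

fun pow2 :: "nat \<Rightarrow> real^'n^'n \<Rightarrow> real^'n^'n" where
  "pow2 0 A = A"
| "pow2 (Suc n) A = pow2 n (A ** A)"

lemma pow2_Suc: "pow2 (Suc n) A = pow2 n A ** pow2 n A"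
  by (induction n arbitrary: A) auto

lemma transpose_pow2: "transpose (pow2 n A) = pow2 n (transpose A)"
  by (induction n arbitrary: A) (auto simp: matrix_transpose_mul)

text \<open>Since (A B)(A B) = A (B A B), moving the leading \<open>A\<close> to the end by the
  induction hypothesis yields (B A)(B A).\<close>

lemma trace_pow2_commute: "trace (pow2 n (A ** B)) = trace (pow2 n (B ** A))"
proof (induction n arbitrary: A B)
  case 0
  show ?case by (simp only: pow2.simps trace_mul_sym[of A B])
next
  case (Suc n)
  have "trace (pow2 (Suc n) (A ** B)) = trace (pow2 n (A ** (B ** A ** B)))"
    by (simp only: pow2.simps matrix_mul_assoc)
  also have "\<dots> = trace (pow2 n (B ** A ** B ** A))"
    by (rule Suc)
  finally show ?case by (simp only: pow2.simps matrix_mul_assoc)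
qed

text \<open>The two claims feed each other, so they share one induction. With N = 2^n, the first
  claim at level n + 1 comes from both claims at level n, applied to Z Z and then to Z Z^T and Z^T
  Z, followed by Cauchy-Schwarz. The second comes from the first at level n with Z = X Y, since X Y
  Y X and X X Y Y have powers of equal trace.\<close>

lemma trace_pow2_mult:
  "(\<forall>Z :: real^'n^'n. \<bar>trace (pow2 (Suc n) Z)\<bar> \<le> trace (pow2 n (Z ** transpose Z))) \<and>
   (\<forall>X Y :: real^'n^'n. transpose X = X \<longrightarrow> transpose Y = Y \<longrightarrow>
      trace (pow2 n (X ** Y)) \<le> trace (pow2 n X ** pow2 n Y))"
proof (induction n)
  case 0
  have "\<bar>trace (Z ** Z)\<bar> \<le> trace (Z ** transpose Z)" for Z :: "real^'n^'n"
  proof -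
    have Z: "(norm (transpose Z))\<^sup>2 = (norm Z)\<^sup>2"
      unfolding norm_matrix_square transpose_transpose by (rule trace_mul_sym)
    then have "norm (transpose Z) = norm Z"
      by (simp only: power2_eq_iff_nonneg norm_ge_zero)
    then have "\<bar>trace (Z ** Z)\<bar> \<le> (norm Z)\<^sup>2"
      using trace_mult_le[of "transpose Z" Z] by (simp add: power2_eq_square)
    then show ?thesis
      by (simp only: norm_matrix_square trace_mul_sym[of "transpose Z" Z])
  qed
  then show ?case by simp
next
  case (Suc n)
  note S = Suc.IH[THEN conjunct1, rule_format]
    and T = Suc.IH[THEN conjunct2, rule_format]
  show ?case
  proof (intro conjI allI impI)
    fix Z :: "real^'n^'n"
    let ?P = "transpose Z ** Z" and ?Q = "Z ** transpose Z"
    have sym: "transpose ?P = ?P" "transpose ?Q = ?Q"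
      by (simp_all add: matrix_transpose_mul)
    have sq: "(norm (pow2 n X))\<^sup>2 = trace (pow2 (Suc n) X)" if "transpose X = X" for X :: "real^'n^'n"
      by (simp add: norm_matrix_square transpose_pow2 that pow2_Suc del: pow2.simps)
    \<comment> \<open>The squared Frobenius norms are traces of powers of Z^T Z and Z Z^T, which
      agree by cyclicity.\<close>
    have eq: "norm (pow2 n ?P) = norm (pow2 n ?Q)"
      using sq[OF sym(1)] sq[OF sym(2)] trace_pow2_commute[of "Suc n" Z "transpose Z"]
      by (intro power2_eq_imp_eq[OF _ norm_ge_zero norm_ge_zero]) (simp only:)
    have "\<bar>trace (pow2 (Suc (Suc n)) Z)\<bar> \<le> trace (pow2 n ((Z ** Z) ** transpose (Z ** Z)))"
      using S[of "Z ** Z"] by simp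
    also have "\<dots> = trace (pow2 n (Z ** (Z ** transpose Z ** transpose Z)))"
      by (simp add: matrix_transpose_mul matrix_mul_assoc)
    also have "\<dots> = trace (pow2 n (?Q ** ?P))"
      by (subst trace_pow2_commute) (simp add: matrix_mul_assoc)
    also have "\<dots> \<le> trace (pow2 n ?Q ** pow2 n ?P)"
      by (rule T[OF sym(2,1)])
    also have "\<dots> \<le> norm (pow2 n ?Q) * norm (pow2 n ?P)"
      using trace_mult_le[of "pow2 n ?Q" "pow2 n ?P"] by (simp add: transpose_pow2 sym)
    also have "\<dots> = trace (pow2 (Suc n) ?Q)"
      using sq[OF sym(2)] by (simp add: eq power2_eq_square)
    finally show "\<bar>trace (pow2 (Suc (Suc n)) Z)\<bar> \<le> trace (pow2 (Suc n) ?Q)" .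
  next
    fix X Y :: "real^'n^'n"
    assume sym: "transpose X = X" "transpose Y = Y"
    have "trace (pow2 (Suc n) (X ** Y)) \<le> trace (pow2 n ((X ** Y) ** transpose (X ** Y)))"
      using S[of "X ** Y"] by linarith
    also have "\<dots> = trace (pow2 n (X ** (Y ** Y ** X)))"
      by (simp add: matrix_transpose_mul sym matrix_mul_assoc)
    also have "\<dots> = trace (pow2 n ((Y ** Y) ** (X ** X)))"
      by (subst trace_pow2_commute) (simp add: matrix_mul_assoc)
    also have "\<dots> = trace (pow2 n ((X ** X) ** (Y ** Y)))"
      by (rule trace_pow2_commute)
    also have "\<dots> \<le> trace (pow2 n (X ** X) ** pow2 n (Y ** Y))"
      by (intro T) (simp_all add: matrix_transpose_mul sym)
    finally show "trace (pow2 (Suc n) (X ** Y)) \<le> trace (pow2 (Suc n) X ** pow2 (Suc n) Y)"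
      by simp
  qed
qed

lemma trace_pow2_mult_le:
  fixes X Y :: "real^'n^'n"
  assumes "transpose X = X" "transpose Y = Y"
  shows "trace (pow2 n (X ** Y)) \<le> trace (pow2 n X ** pow2 n Y)"
  by (rule trace_pow2_mult[THEN conjunct2, rule_format, OF assms])

section \<open>Operator norm bounds and the stability of matrix powers\<close>

definition vbound :: "real^'n^'m \<Rightarrow> real \<Rightarrow> bool" where
  "vbound A b \<longleftrightarrow> (\<forall>x. norm (A *v x) \<le> b * norm x)"

lemma vbound_nonneg: "0 \<le> b" if "vbound A b" for A :: "real^'n^'m"
proof -
  define e :: "real^'n" where "e = axis undefined 1"
  have "norm e = 1"
    by (simp add: e_def norm_axis_1)
  moreover have "norm (A *v e) \<le> b * norm e"
    using that unfolding vbound_def by blast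
  ultimately show ?thesis
    using norm_ge_zero[of "A *v e"] by (metis mult.right_neutral order_trans)
qed

lemma vbound_norm: "vbound A (norm A)" for A :: "real^'n^'m"
  by (simp add: vbound_def norm_matrix_vector_mult_le)

lemma vbound_add: "vbound (A + B) (a + b)" if "vbound A a" "vbound B b" for A B :: "real^'n^'m"
  unfolding vbound_def
proof
  show "norm ((A + B) *v x) \<le> (a + b) * norm x" for x
    using that[unfolded vbound_def, rule_format, of x] norm_triangle_ineq[of "A *v x" "B *v x"]
    by (simp add: matvec.add_left distrib_right)
qed

lemma vbound_mult:
  fixes A :: "real^'n^'m" and B :: "real^'p^'n"
  assumes "vbound A a" "vbound B b"
  shows "vbound (A ** B) (a * b)"
  unfolding vbound_def
proof
  fix x
  have "norm (A *v (B *v x)) \<le> a * norm (B *v x)"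
    using assms by (simp add: vbound_def)
  also have "\<dots> \<le> a * (b * norm x)"
    using assms vbound_nonneg[OF assms(1)] by (intro mult_left_mono) (simp_all add: vbound_def)
  finally show "norm (A ** B *v x) \<le> a * b * norm x"
    by (simp add: matrix_vector_mul_assoc mult_ac)
qed

lemma vbound_mono: "vbound A a \<Longrightarrow> a \<le> b \<Longrightarrow> vbound A b"
  unfolding vbound_def using mult_right_mono[OF _ norm_ge_zero] order_trans by fast

lemma abs_trace_le: "vbound A b \<Longrightarrow> \<bar>trace A\<bar> \<le> real CARD('n) * b" for A :: "real^'n^'n"
proof -
  assume b: "vbound A b"
  have "\<bar>A $ i $ i\<bar> \<le> b" for i
  proof -
    have "A $ i $ i = (A *v axis i 1) $ i"
      by (simp add: matrix_vector_mult_basis column_def)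
    also have "\<bar>\<dots>\<bar> \<le> norm (A *v axis i 1)"
      by (rule component_le_norm_cart)
    also have "\<dots> \<le> b * norm (axis i (1::real) :: real^'n)"
      using b unfolding vbound_def by (rule spec)
    finally show ?thesis by (simp add: norm_axis_1)
  qed
  then have "(\<Sum>i\<in>UNIV. \<bar>A $ i $ i\<bar>) \<le> (\<Sum>i\<in>(UNIV::'n set). b)"
    by (intro sum_mono)
  then show ?thesis
    unfolding trace_def using order_trans[OF sum_abs] by fastforce
qed

text \<open>The telescoping estimate for A^N - B^N with N = 2^n: N terms, each with one difference
  and N - 1 factors of size \<open>b\<close>. It is obtained by repeated squaring from A A - B B = A
  (A - B) + (A - B) B.\<close>

lemma vbound_pow2_diff:
  fixes A B :: "real^'n^'n"
  assumes "vbound A b" "vbound B b" "vbound (A - B) e"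
  shows "vbound (pow2 n A - pow2 n B) (2 ^ n * e * b ^ (2 ^ n - 1))"
  using assms
proof (induction n arbitrary: A B b e)
  case 0
  then show ?case by simp
next
  case (Suc n)
  have b: "0 \<le> b" using Suc.prems vbound_nonneg by blast
  have "A ** A - B ** B = A ** (A - B) + (A - B) ** B"
    by (simp add: matmul.diff_left matmul.diff_right)
  then have d: "vbound (A ** A - B ** B) (b * e + e * b)"
    using Suc.prems by (metis vbound_add vbound_mult)
  have "vbound (pow2 n (A ** A) - pow2 n (B ** B)) (2 ^ n * (b * e + e * b) * (b * b) ^ (2 ^ n - 1))"
    by (rule Suc.IH[OF vbound_mult vbound_mult d]) (use Suc.prems in auto)
  \<comment> \<open>Bookkeeping for the truncated subtraction: one squaring turns the exponent N - 1
    into 1 + 2 (N - 1).\<close>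
  moreover have "(2::nat) ^ Suc n - 1 = Suc (2 * (2 ^ n - 1))"
    by (cases "(2::nat) ^ n") auto
  then have "b * (b * b) ^ (2 ^ n - 1) = b ^ (2 ^ Suc n - 1)"
    by (simp only: power_Suc power_mult power2_eq_square)
  moreover have "2 ^ n * (b * e + e * b) * (b * b) ^ (2 ^ n - 1) =
      2 ^ Suc n * e * (b * (b * b) ^ (2 ^ n - 1))"
    by (simp add: algebra_simps)
  ultimately show ?case
    by (simp only: pow2.simps)
qed

section \<open>Column projections and singular value decompositions\<close>

text \<open>The projection is the sum of the outer squares of an orthonormal basis of
  \<open>S\<close>.\<close>

lemma orthogonal_projection_matrix_exists:
  fixes S :: "(real^'n) set"
  assumes "subspace S"
  obtains P :: "real^'n^'n" where "transpose P = P" "\<And>x. P *v x \<in> S" "\<And>x. x \<in> S \<Longrightarrow> P *v x = x"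
proof -
  obtain B where B: "B \<subseteq> S" "pairwise orthogonal B" "\<And>x. x \<in> B \<Longrightarrow> norm x = 1"
      "independent B" "span B = S"
    using orthonormal_basis_subspace[OF assms] by metis
  have fin: "finite B" using B independent_imp_finite by blast
  define P where "P = (\<Sum>b\<in>B. outer b b)"
  have P: "P *v x = (\<Sum>b\<in>B. (b \<bullet> x) *\<^sub>R b)" for x
    by (simp add: P_def matvec.sum_left outer_mult_vector)
  show thesis
  proof
    show "transpose P = P"
      unfolding P_def using fin
      by (induction B rule: finite_induct) (auto simp: transpose_add transpose_outer)
    show "P *v x \<in> S" for x
      unfolding P using B(1) assms by (intro subspace_sum subspace_scale) auto
    have id: "P *v b = b" if "b \<in> B" for b
    proof -
      have "P *v b = (\<Sum>c\<in>B. if c = b then b else 0)"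
        unfolding P using B(2,3) that
        by (intro sum.cong) (auto simp: pairwise_def orthogonal_def norm_eq_1)
      then show ?thesis using that fin by simp
    qed
    show "P *v x = x" if "x \<in> S" for x
      using that unfolding B(5) [symmetric]
      by (induction rule: span_induct_alt)
         (auto simp: matvec.add_right matvec.scaleR_right id)
  qed
qed

section \<open>The Moore-Penrose inverse and the column projection\<close>

lemma is_pinv_unique:
  assumes X: "is_pinv C X" and Y: "is_pinv C Y"
  shows "X = Y"
proof -
  note x = X[unfolded is_pinv_def] and y = Y[unfolded is_pinv_def]
  have "C ** X = transpose (C ** X)" using x by simp
  also have "\<dots> = transpose ((C ** Y) ** (C ** X))" using y by (simp add: matrix_mul_assoc)
  also have "\<dots> = (C ** X) ** (C ** Y)" using x y by (simp add: matrix_transpose_mul[of "C ** Y"])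
  also have "\<dots> = C ** Y" using x by (simp add: matrix_mul_assoc)
  finally have CX: "C ** X = C ** Y" .
  have "X ** C = transpose (X ** C)" using x by simp
  also have "\<dots> = transpose ((X ** C) ** (Y ** C))" using y by (metis matrix_mul_assoc)
  also have "\<dots> = (Y ** C) ** (X ** C)" using x y by (simp add: matrix_transpose_mul[of "X ** C"])
  also have "\<dots> = Y ** C" using x by (metis matrix_mul_assoc)
  finally have XC: "X ** C = Y ** C" .
  have "X = X ** (C ** X)" using x by (simp add: matrix_mul_assoc)
  also have "\<dots> = Y ** C ** Y" unfolding CX by (simp add: matrix_mul_assoc XC)
  finally show ?thesis using y by simp
qed

text \<open>\<open>C\<close> is injective on its row space, the range of its transpose. A left
  inverse \<open>G\<close> on that space, placed between the projections \<open>PL\<close> onto the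
  row space and \<open>PR\<close> onto the column space, satisfies C X = \<open>PR\<close> and X C =
  \<open>PL\<close>, from which all four equations follow.\<close>

lemma is_pinv_exists:
  fixes C :: "real^'n^'m"
  shows "\<exists>X. is_pinv C X"
proof -
  let ?L = "range ((*v) (transpose C))" and ?R = "range ((*v) C)"
  have sub: "subspace ?L" "subspace ?R"
    by (intro linear_subspace_image matrix_vector_mul_linear subspace_UNIV)+
  obtain PL :: "real^'n^'n" where PL: "transpose PL = PL" "\<And>x. PL *v x \<in> ?L" "\<And>x. x \<in> ?L \<Longrightarrow> PL *v x = x"
    using orthogonal_projection_matrix_exists[OF sub(1)] by metis
  obtain PR :: "real^'m^'m" where PR: "transpose PR = PR" "\<And>x. PR *v x \<in> ?R" "\<And>x. x \<in> ?R \<Longrightarrow> PR *v x = x"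
    using orthogonal_projection_matrix_exists[OF sub(2)] by metis
  have "PL ** transpose C = transpose C"
    by (rule matrix_eq[THEN iffD2]) (simp add: PL flip: matrix_vector_mul_assoc del: transpose_matrix_vector)
  then have CPL: "C ** PL = C"
    by (metis PL(1) matrix_transpose_mul transpose_transpose)
  have PRC: "PR ** C = C"
    by (rule matrix_eq[THEN iffD2]) (simp add: PR flip: matrix_vector_mul_assoc)
  \<comment> \<open>A difference in the row space has the form C^T w, so its squared norm is the
    inner product of C (x - y) = 0 with \<open>w\<close>.\<close>
  have inj: "inj_on ((*v) C) ?L"
  proof (rule inj_onI)
    fix x y assume xy: "x \<in> ?L" "y \<in> ?L" "C *v x = C *v y"
    obtain w where w: "x - y = transpose C *v w"
      using xy subspace_diff[OF sub(1)] by blast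
    have "(x - y) \<bullet> (x - y) = (C *v (x - y)) \<bullet> w"
      unfolding inner_matrix_vector_left w [symmetric] ..
    also have "\<dots> = 0" using xy by (simp add: matvec.diff_right)
    finally show "x = y" by simp
  qed
  obtain g where g: "linear g" "\<And>x. x \<in> ?L \<Longrightarrow> g (C *v x) = x"
    using linear_exists_left_inverse_on[OF matrix_vector_mul_linear sub(1) inj] by auto
  define G where "G = matrix g"
  have G: "G *v x = g x" for x
    by (simp add: G_def g matrix_works)
  have gC: "g (C *v (PL *v x)) = PL *v x" for x
    by (rule g(2)[OF PL(2)])
  have GC: "G ** C ** PL = PL"
    by (rule matrix_eq[THEN iffD2]) (simp add: G gC flip: matrix_vector_mul_assoc)
  define X where "X = PL ** G ** PR"
  have "C ** G ** PR = PR"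
  proof (rule matrix_eq[THEN iffD2], rule allI)
    fix x
    obtain z where "PR *v x = C *v z" using PR(2) by blast
    then have "PR *v x = C *v (PL *v z)" by (simp add: matrix_vector_mul_assoc CPL)
    then show "C ** G ** PR *v x = PR *v x"
      by (simp add: G gC flip: matrix_vector_mul_assoc)
  qed
  then have CX: "C ** X = PR"
    by (simp add: X_def matrix_mul_assoc CPL)
  have PL2: "PL ** PL = PL"
    by (rule matrix_eq[THEN iffD2]) (simp add: PL(3)[OF PL(2)] flip: matrix_vector_mul_assoc)
  have "X ** C = PL ** (G ** (PR ** C))"
    by (simp add: X_def matrix_mul_assoc)
  also have "\<dots> = PL ** (G ** (C ** PL))"
    by (simp only: PRC CPL)
  also have "\<dots> = PL"
    using GC PL2 by (simp add: matrix_mul_assoc)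
  finally have XC: "X ** C = PL" .
  have "PL ** X = X"
    by (simp only: X_def matrix_mul_assoc PL2)
  then show ?thesis
    by (intro exI[of _ X]) (simp only: is_pinv_def CX XC PRC PL(1) PR(1))
qed

lemma is_pinv_pinv: "is_pinv C (pinv C)"
proof -
  obtain X where X: "is_pinv C X"
    using is_pinv_exists by blast
  then show ?thesis
    unfolding pinv_def by (rule theI) (rule is_pinv_unique[OF _ X])
qed

lemma col_proj_mult_self: "col_proj C ** C = C"
  using is_pinv_pinv[of C] by (simp add: col_proj_def is_pinv_def)

lemma transpose_col_proj: "transpose (col_proj C) = col_proj C"
  using is_pinv_pinv[of C] by (simp add: col_proj_def is_pinv_def)

lemma col_proj_idem: "col_proj C ** col_proj C = col_proj C"
proof -
  have "col_proj C ** col_proj C = col_proj C ** C ** pinv C"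
    by (simp only: col_proj_def[of C] matrix_mul_assoc)
  then show ?thesis
    by (simp only: col_proj_mult_self) (simp only: col_proj_def)
qed

lemma norm_diff_projection_le:
  fixes P :: "real^'n^'n"
  assumes "transpose P = P" "P ** P = P"
  shows "norm (x - P *v x) \<le> norm x"
proof -
  have "(x - P *v x) \<bullet> (P *v x) = 0"
    by (simp add: inner_diff_left inner_symmetric_matrix[OF assms(1)] matrix_vector_mul_assoc assms)
  then have "(norm x)\<^sup>2 = (norm (x - P *v x))\<^sup>2 + (norm (P *v x))\<^sup>2"
    using norm_add_Pythagorean[of "x - P *v x" "P *v x"] by (simp add: orthogonal_def)
  then have "(norm (x - P *v x))\<^sup>2 \<le> (norm x)\<^sup>2"
    by simp
  then show ?thesis
    by (rule power2_le_imp_le) simp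
qed

lemma norm_projection_le:
  fixes P :: "real^'n^'n"
  assumes "transpose P = P" "P ** P = P"
  shows "norm (P *v x) \<le> norm x"
proof -
  have "(norm (P *v x))\<^sup>2 = x \<bullet> (P *v x)"
    by (simp add: power2_norm_eq_inner inner_symmetric_matrix[OF assms(1)] matrix_vector_mul_assoc assms)
  also have "\<dots> \<le> norm x * norm (P *v x)"
    by (rule norm_cauchy_schwarz)
  finally show ?thesis
    by (cases "P *v x = 0") (auto simp: power2_eq_square)
qed

text \<open>As the projection fixes \<open>C\<close>, the residual at \<open>x\<close> is the
  complementary projection of A x - C z for every \<open>z\<close>; any competitor \<open>z\<close>
  therefore gives an upper bound.\<close>

lemma norm_residual_col_proj_le:
  fixes A :: "real^'n^'m" and C :: "real^'l^'m"
  shows "norm ((A - col_proj C ** A) *v x) \<le> norm (A *v x - C *v z)"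
proof -
  have "(A - col_proj C ** A) *v x = (A *v x - C *v z) - col_proj C *v (A *v x - C *v z)"
    by (simp add: matvec.diff_left matvec.diff_right matrix_vector_mul_assoc col_proj_mult_self)
  then show ?thesis
    using norm_diff_projection_le[OF transpose_col_proj col_proj_idem] by metis
qed

text \<open>For an orthonormal family this is the orthogonal projection onto the span of the vectors
  indexed by \<open>I\<close>. The index set is a parameter so that leading and trailing singular
  vectors are treated alike.\<close>

definition frame :: "nat set \<Rightarrow> (nat \<Rightarrow> real^'n) \<Rightarrow> real^'n^'n" where
  "frame I w = (\<Sum>a\<in>I. outer (w a) (w a))"

lemma frame_mult_vector: "frame I w *v x = (\<Sum>a\<in>I. (w a \<bullet> x) *\<^sub>R w a)"
  by (simp add: frame_def matvec.sum_left outer_mult_vector)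

lemma transpose_sum: "transpose (\<Sum>a\<in>I. F a) = (\<Sum>a\<in>I. transpose (F a :: real^'n^'m))"
  by (induction I rule: infinite_finite_induct) (auto simp: transpose_add)

lemma transpose_frame: "transpose (frame I w) = frame I w"
  by (simp add: frame_def transpose_sum transpose_outer)

context
  fixes r :: nat and w :: "nat \<Rightarrow> real^'n"
  assumes w: "orthonormal_upto r w"
begin

lemma inner_orthonormal: "a < r \<Longrightarrow> b < r \<Longrightarrow> w a \<bullet> w b = (if a = b then 1 else 0)"
  using w by (simp add: orthonormal_upto_def)

lemma inner_frame:
  assumes "I \<subseteq> {..<r}" "a < r"
  shows "w a \<bullet> (frame I w *v x) = (if a \<in> I then w a \<bullet> x else 0)"
proof -
  have "finite I" using assms finite_subset by blast
  have "w a \<bullet> (frame I w *v x) = (\<Sum>b\<in>I. if b = a then w b \<bullet> x else 0)"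
    unfolding frame_mult_vector inner_sum_right using assms
    by (intro sum.cong) (auto simp: inner_orthonormal)
  then show ?thesis using \<open>finite I\<close> by simp
qed

text \<open>Equal index sets give idempotence, disjoint ones the orthogonality of the head and tail
  projections.\<close>

lemma frame_mult_frame:
  assumes "I \<subseteq> {..<r}" "I' \<subseteq> {..<r}"
  shows "frame I w ** frame I' w = frame (I \<inter> I') w"
proof (rule matrix_eq[THEN iffD2], rule allI)
  fix x
  have fin: "finite I" using assms finite_subset by blast
  have "frame I w ** frame I' w *v x = (\<Sum>a\<in>I. if a \<in> I' then (w a \<bullet> x) *\<^sub>R w a else 0)"
    unfolding matrix_vector_mul_assoc [symmetric] frame_mult_vector[of I]
    using assms by (intro sum.cong) (auto simp: inner_frame)
  then show "frame I w ** frame I' w *v x = frame (I \<inter> I') w *v x"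
    using fin by (simp add: frame_mult_vector sum.inter_restrict)
qed

lemma trace_frame:
  assumes "I \<subseteq> {..<r}"
  shows "trace (frame I w) = card I"
proof -
  have "trace (frame I w) = (\<Sum>a\<in>I. w a \<bullet> w a)"
    unfolding frame_def
    by (induction I rule: infinite_finite_induct) (auto simp: trace_add trace_outer trace_0[unfolded mat_0])
  also have "\<dots> = (\<Sum>a\<in>I. 1)"
    using assms by (intro sum.cong) (auto simp: inner_orthonormal)
  finally show ?thesis by simp
qed

lemma norm_sum_orthonormal:
  assumes "I \<subseteq> {..<r}"
  shows "(norm (\<Sum>a\<in>I. c a *\<^sub>R w a))\<^sup>2 = (\<Sum>a\<in>I. (c a)\<^sup>2)"
proof -
  have fin: "finite I" using assms finite_subset by blast
  have "(norm (\<Sum>a\<in>I. c a *\<^sub>R w a))\<^sup>2 = (\<Sum>a\<in>I. (norm (c a *\<^sub>R w a))\<^sup>2)"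
    using fin assms
    by (intro norm_sum_Pythagorean) (auto simp: pairwise_def orthogonal_def inner_orthonormal subset_iff)
  also have "\<dots> = (\<Sum>a\<in>I. (c a)\<^sup>2)"
    using assms by (intro sum.cong refl) (auto simp: norm_eq_sqrt_inner inner_orthonormal subset_iff)
  finally show ?thesis .
qed

lemma norm_frame: "I \<subseteq> {..<r} \<Longrightarrow> (norm (frame I w *v x))\<^sup>2 = (\<Sum>a\<in>I. (w a \<bullet> x)\<^sup>2)"
  by (simp add: frame_mult_vector norm_sum_orthonormal)

end

section \<open>Singular value decomposition and best low-rank approximation\<close>

lemma svd_mat_mult_vector: "svd_mat r \<sigma> u v *v x = (\<Sum>a<r. (\<sigma> a * (v a \<bullet> x)) *\<^sub>R u a)"
proof -
  have "svd_mat r \<sigma> u v = (\<Sum>a<r. \<sigma> a *\<^sub>R outer (u a) (v a))"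
    by (simp add: svd_mat_def outer_def vec_eq_iff mult_ac)
  then show ?thesis
    by (simp add: matvec.sum_left matvec.scaleR_left outer_mult_vector)
qed

lemma leverage_eq_norm:
  assumes "orthonormal_upto r v" "k \<le> r"
  shows "leverage k v i = (norm (frame {..<k} v *v axis i 1))\<^sup>2"
  using assms by (simp add: norm_frame[OF assms(1)] leverage_def inner_axis)

lemma spectral_norm_le:
  "(\<And>x. norm (A *v x) \<le> b * norm x) \<Longrightarrow> spectral_norm A \<le> b"
  unfolding spectral_norm_def by (rule onorm_le)

lemma norm_le_spectral_norm: "norm (A *v x) \<le> spectral_norm A * norm x"
  unfolding spectral_norm_def by (rule onorm) simp

context
  fixes A :: "real^'n^'m" and r k :: nat and \<sigma> u v
  assumes svd: "thin_svd A r \<sigma> u v" and k: "k < r"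
begin

lemma uv: "orthonormal_upto r u" "orthonormal_upto r v"
  using svd by (auto simp: thin_svd_def)

text \<open>Pythagoras in the left singular vectors, together with \<sigma> a \<le> \<sigma> k on
  the tail.\<close>

lemma norm_svd_tail_le:
  "norm (\<Sum>a=k..<r. (\<sigma> a * c a) *\<^sub>R u a) \<le> \<sigma> k * sqrt (\<Sum>a=k..<r. (c a)\<^sup>2)"
proof -
  have s: "0 \<le> \<sigma> a" "\<sigma> a \<le> \<sigma> k" if "a \<in> {k..<r}" for a
    using svd that by (auto simp: thin_svd_def)
  have "(norm (\<Sum>a=k..<r. (\<sigma> a * c a) *\<^sub>R u a))\<^sup>2 = (\<Sum>a=k..<r. (\<sigma> a * c a)\<^sup>2)"
    by (rule norm_sum_orthonormal[OF uv(1)]) auto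
  also have "\<dots> \<le> (\<Sum>a=k..<r. (\<sigma> k)\<^sup>2 * (c a)\<^sup>2)"
    unfolding power_mult_distrib using s by (intro sum_mono mult_right_mono power_mono) auto
  also have "\<dots> = (\<sigma> k * sqrt (\<Sum>a=k..<r. (c a)\<^sup>2))\<^sup>2"
    by (simp add: power_mult_distrib sum_nonneg flip: sum_distrib_left)
  finally show ?thesis
    by (rule power2_le_imp_le) (use s(1)[of k] k in \<open>auto simp: sum_nonneg\<close>)
qed

lemma svd_mult_vector: "A *v x = (\<Sum>a<r. (\<sigma> a * (v a \<bullet> x)) *\<^sub>R u a)"
  using svd by (simp add: thin_svd_def svd_mat_mult_vector)

lemma svd_split_tail: "(A - svd_mat k \<sigma> u v) *v x = (\<Sum>a=k..<r. (\<sigma> a * (v a \<bullet> x)) *\<^sub>R u a)"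
proof -
  have "(\<Sum>a<r. F a) = (\<Sum>a<k. F a) + (\<Sum>a=k..<r. F a)" for F :: "nat \<Rightarrow> real^'m"
    using sum.atLeastLessThan_concat[of 0 k r F] k by (simp add: lessThan_atLeast0)
  then show ?thesis
    by (simp add: matvec.diff_left svd_mult_vector svd_mat_mult_vector)
qed

text \<open>Bessel's inequality bounds the tail by \<open>\<sigma> k\<close>, and the vector
  \<open>v k\<close> attains this value.\<close>

lemma spectral_norm_tail: "spectral_norm (A - svd_mat k \<sigma> u v) = \<sigma> k"
proof (rule antisym)
  have s: "0 \<le> \<sigma> k" using svd k by (auto simp: thin_svd_def)
  show "spectral_norm (A - svd_mat k \<sigma> u v) \<le> \<sigma> k"
  proof (rule spectral_norm_le)
    fix x
    have "sqrt (\<Sum>a=k..<r. (v a \<bullet> x)\<^sup>2) = norm (frame {k..<r} v *v x)"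
      by (subst norm_frame[OF uv(2), symmetric]) auto
    also have "\<dots> \<le> norm x"
      by (intro norm_projection_le transpose_frame) (subst frame_mult_frame[OF uv(2)], auto)
    finally show "norm ((A - svd_mat k \<sigma> u v) *v x) \<le> \<sigma> k * norm x"
      unfolding svd_split_tail using norm_svd_tail_le s by (meson mult_left_mono order_trans)
  qed
  have "(A - svd_mat k \<sigma> u v) *v v k = (\<Sum>a=k..<r. if a = k then \<sigma> k *\<^sub>R u k else 0)"
    unfolding svd_split_tail using k
    by (intro sum.cong) (auto simp: inner_orthonormal[OF uv(2)])
  also have "\<dots> = \<sigma> k *\<^sub>R u k" using k by simp
  finally have "norm ((A - svd_mat k \<sigma> u v) *v v k) = \<sigma> k"
    using s inner_orthonormal[OF uv(1) k k] by (simp add: norm_eq_sqrt_inner)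
  then show "\<sigma> k \<le> spectral_norm (A - svd_mat k \<sigma> u v)"
    using norm_le_spectral_norm[of "A - svd_mat k \<sigma> u v" "v k"] inner_orthonormal[OF uv(2) k k]
    by (simp add: norm_eq_sqrt_inner)
qed

text \<open>The lower half of the Eckart-Young theorem. The span of \<open>v 0\<close>, ...,
  \<open>v k\<close> has dimension k + 1, so it contains a nonzero vector in the kernel of
  \<open>B\<close>; there A - B acts as \<open>A\<close>, which stretches by at least
  \<open>\<sigma> k\<close>.\<close>

lemma sigma_le_spectral_norm_diff:
  assumes "rank B \<le> k"
  shows "\<sigma> k \<le> spectral_norm (A - B)"
proof -
  let ?S = "v ` {..k}"
  have vin: "v a \<bullet> v b = (if a = b then 1 else 0)" if "a \<le> k" "b \<le> k" for a b
    using that k by (intro inner_orthonormal[OF uv(2)]) auto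
  have "inj_on v {..k}"
    using vin by (intro inj_onI) (metis atMost_iff zero_neq_one)
  moreover have "independent ?S"
    by (rule pairwise_orthogonal_independent) (auto simp: pairwise_def orthogonal_def vin, metis inner_zero_left order_refl vin zero_neq_one)
  ultimately have "dim ?S = k + 1"
    by (simp add: dim_eq_card_independent card_image)
  moreover have "dim ((*v) B ` ?S) \<le> k"
    using dim_subset[of "(*v) B ` ?S" "range ((*v) B)"] assms by (fastforce simp: rank_dim_range)
  ultimately have "\<not> inj_on ((*v) B) (span ?S)"
    using dim_image_eq[of "(*v) B" ?S] by fastforce
  then obtain x where x: "x \<in> span ?S" "x \<noteq> 0" "B *v x = 0"
    using linear_inj_on_iff_eq_0[OF matrix_vector_mul_linear[of B] subspace_span[of ?S]] by blast
  have id: "frame {..k} v *v v b = v b" if "b \<le> k" for b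
  proof -
    have "frame {..k} v *v v b = (\<Sum>a\<le>k. if a = b then v b else 0)"
      unfolding frame_mult_vector using that by (intro sum.cong) (auto simp: vin)
    then show ?thesis using that by simp
  qed
  \<comment> \<open>A vector of the span is fixed by the projection, so Parseval holds for it with
    equality.\<close>
  have fx: "frame {..k} v *v x = x"
    using x(1) by (induction rule: span_induct_alt) (auto simp: matvec.add_right matvec.scaleR_right id)
  have sub: "{..k} \<subseteq> {..<r}"
    using k by auto
  have nx: "(norm x)\<^sup>2 = (\<Sum>a\<le>k. (v a \<bullet> x)\<^sup>2)"
    using norm_frame[OF uv(2) sub, of x] unfolding fx .
  have s: "0 \<le> \<sigma> k" "\<And>a. a \<le> k \<Longrightarrow> \<sigma> k \<le> \<sigma> a" using svd k by (auto simp: thin_svd_def)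
  have "(norm ((A - B) *v x))\<^sup>2 = (norm (A *v x))\<^sup>2"
    by (simp add: matvec.diff_left x(3))
  also have "\<dots> = (\<Sum>a<r. (\<sigma> a * (v a \<bullet> x))\<^sup>2)"
    unfolding svd_mult_vector by (rule norm_sum_orthonormal[OF uv(1)]) auto
  also have "\<dots> \<ge> (\<Sum>a\<le>k. (\<sigma> a * (v a \<bullet> x))\<^sup>2)"
    using k by (intro sum_mono2) auto
  finally have "(\<Sum>a\<le>k. (\<sigma> a * (v a \<bullet> x))\<^sup>2) \<le> (norm ((A - B) *v x))\<^sup>2" .
  moreover have "(\<sigma> k * norm x)\<^sup>2 \<le> (\<Sum>a\<le>k. (\<sigma> a * (v a \<bullet> x))\<^sup>2)"
    unfolding power_mult_distrib nx sum_distrib_left using s k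
    by (intro sum_mono) (auto intro!: mult_right_mono power_mono)
  ultimately have "(\<sigma> k * norm x)\<^sup>2 \<le> (norm ((A - B) *v x))\<^sup>2"
    by linarith
  then have "\<sigma> k * norm x \<le> norm ((A - B) *v x)"
    by (rule power2_le_imp_le) simp
  also have "\<dots> \<le> spectral_norm (A - B) * norm x"
    by (rule norm_le_spectral_norm)
  finally show ?thesis using x(2) by simp
qed

lemma best_rank_approx_svd: "best_rank_approx k A (svd_mat k \<sigma> u v)"
proof -
  have "range ((*v) (svd_mat k \<sigma> u v)) \<subseteq> span (u ` {..<k})"
    by (auto simp: svd_mat_mult_vector intro!: span_sum span_scale intro: span_base)
  then have "rank (svd_mat k \<sigma> u v) \<le> card (u ` {..<k})"
    unfolding rank_dim_range by (intro dim_le_card) auto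
  also have "\<dots> \<le> k" using card_image_le[of "{..<k}" u] by simp
  finally show ?thesis
    unfolding best_rank_approx_def spectral_norm_tail using sigma_le_spectral_norm_diff by blast
qed

end

section \<open>The deterministic bound on the residual\<close>

lemma col_select_mult_vector:
  "col_select A f *v z = A *v (\<Sum>t\<in>UNIV. z $ t *\<^sub>R axis (f t) 1)"
  by (simp add: matvec.sum_right matvec.scaleR_right matrix_vector_mult_basis vec_eq_iff column_def
      col_select_def) (simp add: matrix_vector_mult_def mult.commute)

text \<open>For each \<open>x\<close> a competitor C z = A g is built with P g = P x, so that only
  the tail remains: A x - A g = A Q (x - S h). Here \<open>h\<close> solves G h = P x within the
  range of \<open>P\<close>, and coercivity gives |h| \<le> 2 |x|, the source of the factor
  2.\<close>

lemma spectral_norm_residual_le: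
  fixes A :: "real^'n^'m" and f :: "'l::finite \<Rightarrow> 'n" and c :: "'n \<Rightarrow> real"
  assumes svd: "thin_svd A r \<sigma> u v" and k: "k < r"
  defines "P \<equiv> frame {..<k} v" and "Q \<equiv> frame {k..<r} v"
  defines "G \<equiv> \<Sum>t\<in>UNIV. c (f t) *\<^sub>R outer (P *v axis (f t) 1) (P *v axis (f t) 1)"
    and "S \<equiv> \<Sum>t\<in>UNIV. c (f t) *\<^sub>R outer (Q *v axis (f t) 1) (P *v axis (f t) 1)"
  assumes coercive: "\<And>x. P *v x = x \<Longrightarrow> (norm x)\<^sup>2 / 2 \<le> x \<bullet> (G *v x)"
  shows "spectral_norm (A - col_proj (col_select A f) ** A) \<le> \<sigma> k * (1 + 2 * norm S)"
proof (rule spectral_norm_le)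
  fix x
  note v = uv(2)[OF svd k]
  have sub: "{..<k} \<subseteq> {..<r}" "{k..<r} \<subseteq> {..<r}"
    using k by auto
  have PP: "P ** P = P" and QQ: "Q ** Q = Q"
    unfolding P_def Q_def using k by (subst frame_mult_frame[OF v]; auto)+
  have Pt: "transpose P = P"
    unfolding P_def by (rule transpose_frame)
  have s: "0 \<le> \<sigma> k" using svd k by (auto simp: thin_svd_def)
  have GP: "G ** P = G"
    unfolding G_def matmul.sum_left
    by (simp add: matmul.scaleR_left outer_mult Pt matrix_vector_mul_assoc PP del: transpose_matrix_vector)
  have PG: "P ** G = G"
    unfolding G_def matmul.sum_right
    by (simp add: matmul.scaleR_right mult_outer matrix_vector_mul_assoc PP)

  txt \<open>\<open>H\<close> extends \<open>G\<close> from the range of \<open>P\<close> to an invertible matrix.\<close>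
  define H where "H = G + mat 1 - P"
  have H: "H *v y = G *v y + (y - P *v y)" for y
    by (simp add: H_def matvec.add_left matvec.diff_left)
  have "inj ((*v) H)"
  proof (rule linear_injective_0[OF matrix_vector_mul_linear, THEN iffD2], intro allI impI)
    fix y assume y: "H *v y = 0"
    have "P *v (H *v y) = G *v y"
      by (simp add: H matvec.add_right matvec.diff_right matrix_vector_mul_assoc PP PG)
    then have Gy: "G *v y = 0" using y by simp
    then have Py: "P *v y = y" using y by (simp add: H)
    then show "y = 0" using coercive[OF Py] Gy by simp
  qed
  then obtain h where h: "H *v h = P *v x"
    using linear_injective_imp_surjective[OF matrix_vector_mul_linear, of H] by (metis surjD)
  have "P *v (H *v h) = G *v h"
    by (simp add: H matvec.add_right matvec.diff_right matrix_vector_mul_assoc PP PG)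
  then have Gh: "G *v h = P *v x"
    unfolding h by (simp add: matrix_vector_mul_assoc PP)
  then have Ph: "P *v h = h" using h by (simp add: H)
  have "(norm h)\<^sup>2 / 2 \<le> h \<bullet> (P *v x)"
    using coercive[OF Ph] by (simp add: Gh)
  also have "\<dots> \<le> norm h * norm x"
    using norm_cauchy_schwarz[of h "P *v x"] norm_projection_le[OF Pt PP, of x]
    by (meson mult_left_mono norm_ge_zero order_trans)
  finally have nh: "norm h \<le> 2 * norm x"
    by (cases "h = 0") (auto simp: power2_eq_square)

  \<comment> \<open>These coefficients make the combination of the P e_i over the draws equal to G h
    = P x, and that of the Q e_i equal to S h.\<close>
  define z :: "real^'l" where "z = (\<chi> t. c (f t) * ((P *v axis (f t) 1) \<bullet> h))"
  define g where "g = (\<Sum>t\<in>UNIV. z $ t *\<^sub>R axis (f t) (1::real))"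
  have Pg: "P *v g = P *v x"
    unfolding Gh [symmetric] g_def G_def
    by (simp add: matvec.sum_right matvec.sum_left matvec.scaleR_right matvec.scaleR_left
        outer_mult_vector z_def)
  have Qg: "Q *v g = S *v h"
    unfolding g_def S_def
    by (simp add: matvec.sum_right matvec.sum_left matvec.scaleR_right matvec.scaleR_left
        outer_mult_vector z_def)
  have AQ: "A *v (Q *v y) = (A - svd_mat k \<sigma> u v) *v y" for y
  proof -
    have "A *v (Q *v y) = (\<Sum>a<r. if a \<in> {k..<r} then (\<sigma> a * (v a \<bullet> y)) *\<^sub>R u a else 0)"
      unfolding svd_mult_vector[OF svd k] Q_def
      by (intro sum.cong) (auto simp: inner_frame[OF v sub(1)] inner_frame[OF v sub(2)])
    also have "\<dots> = (\<Sum>a\<in>{..<r} \<inter> {k..<r}. (\<sigma> a * (v a \<bullet> y)) *\<^sub>R u a)"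
      by (rule sum.inter_restrict [symmetric]) simp
    also have "{..<r} \<inter> {k..<r} = {k..<r}" by auto
    finally show ?thesis
      by (simp add: svd_split_tail[OF svd k])
  qed
  have split: "A *v y = A *v (P *v y) + A *v (Q *v y)" for y
    unfolding svd_mult_vector[OF svd k] sum.distrib [symmetric] P_def Q_def using k
    by (intro sum.cong) (auto simp: inner_frame[OF v sub(1)] inner_frame[OF v sub(2)])
  have "A *v x - A *v g = A *v (Q *v (x - S *v h))"
    using split[of x] split[of g] Qg QQ
    by (simp add: Pg matvec.diff_right matrix_vector_mul_assoc)
       (metis QQ Qg matrix_vector_mul_assoc)
  then have "norm (A *v x - A *v g) \<le> \<sigma> k * norm (x - S *v h)"
    unfolding AQ using norm_le_spectral_norm[of "A - svd_mat k \<sigma> u v" "x - S *v h"]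
    by (simp add: spectral_norm_tail[OF svd k])
  also have "\<dots> \<le> \<sigma> k * (norm x + norm S * (2 * norm x))"
  proof (intro mult_left_mono s)
    have "norm (x - S *v h) \<le> norm x + norm S * norm h"
      using norm_triangle_ineq4[of x "S *v h"] norm_matrix_vector_mult_le[of S h] by linarith
    also have "norm S * norm h \<le> norm S * (2 * norm x)"
      by (intro mult_left_mono nh) simp
    finally show "norm (x - S *v h) \<le> norm x + norm S * (2 * norm x)" by simp
  qed
  also have "\<dots> = \<sigma> k * (1 + 2 * norm S) * norm x"
    by (simp add: algebra_simps)
  finally have "norm (A *v x - A *v g) \<le> \<sigma> k * (1 + 2 * norm S) * norm x" .
  moreover have "norm ((A - col_proj (col_select A f) ** A) *v x) \<le> norm (A *v x - A *v g)"
    using norm_residual_col_proj_le[of A "col_select A f" x z]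
    by (simp add: col_select_mult_vector g_def)
  ultimately show "norm ((A - col_proj (col_select A f) ** A) *v x) \<le> \<sigma> k * (1 + 2 * norm S) * norm x"
    by linarith
qed

section \<open>A Bernstein inequality for random vectors\<close>

text \<open>Fubini for product weights: the draw \<open>t\<close> is fixed at \<open>i\<close> while
  the others are averaged, and is itself averaged last.\<close>

lemma sum_PiE_insert:
  fixes p :: "'i::finite \<Rightarrow> real" and F :: "('t \<Rightarrow> 'i) \<Rightarrow> real"
  assumes "finite T" "t \<notin> T"
  shows "(\<Sum>f\<in>PiE (insert t T) (\<lambda>_. UNIV). (\<Prod>j\<in>insert t T. p (f j)) * F f) =
    (\<Sum>i\<in>UNIV. p i * (\<Sum>f\<in>PiE T (\<lambda>_. UNIV). (\<Prod>j\<in>T. p (f j)) * F (f(t := i))))"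
proof -
  have inj: "inj_on (\<lambda>(i, f). f(t := i)) ((UNIV :: 'i set) \<times> PiE T (\<lambda>_. UNIV))"
    using assms(2) by (rule inj_combinator)
  have prod: "(\<Prod>j\<in>T. p (if j = t then i else f j)) = (\<Prod>j\<in>T. p (f j))" for i f
    using assms by (intro prod.cong) auto
  show ?thesis
    unfolding PiE_insert_eq sum.reindex[OF inj] using assms
    by (simp add: case_prod_beta prod sum_distrib_left mult_ac sum.cartesian_product')
qed

text \<open>
  For the matrix Chernoff bound \<open>n\<close> is the discretization level of the matrix exponential, for which
  the one-step estimate only holds up to an error vanishing in the limit.
\<close>

lemma random_sum_drift:
  fixes p :: "'i::finite \<Rightarrow> real" and X :: "'i \<Rightarrow> 'b::ab_group_add"
    and g :: "nat \<Rightarrow> 'b \<Rightarrow> real"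
  assumes p: "\<And>i. 0 \<le> p i"
    and a: "\<And>n. 0 \<le> a n" "a \<longlonglongrightarrow> a'"
    and Z: "\<And>z i. z \<in> Z \<Longrightarrow> z + X i \<in> Z"
    and step: "\<And>z. z \<in> Z \<Longrightarrow>
      \<exists>e. e \<longlonglongrightarrow> 0 \<and> (\<forall>n. (\<Sum>i\<in>UNIV. p i * g n (z + X i)) \<le> a n * g n z + e n)"
    and "finite T" "z \<in> Z"
  shows "\<exists>e. e \<longlonglongrightarrow> 0 \<and> (\<forall>n. (\<Sum>f\<in>PiE T (\<lambda>_. UNIV). (\<Prod>t\<in>T. p (f t)) *
    g n (z + (\<Sum>t\<in>T. X (f t)))) \<le> a n ^ card T * g n z + e n)"
  using \<open>finite T\<close> \<open>z \<in> Z\<close>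
proof (induction T arbitrary: z)
  case empty
  show ?case by (auto intro!: exI[of _ "\<lambda>_. 0"])
next
  case (insert t T)
  let ?S = "\<lambda>n z. \<Sum>f\<in>PiE T (\<lambda>_. UNIV). (\<Prod>t\<in>T. p (f t)) * g n (z + (\<Sum>t\<in>T. X (f t)))"
  have "\<forall>i. \<exists>e. e \<longlonglongrightarrow> 0 \<and> (\<forall>n. ?S n (z + X i) \<le> a n ^ card T * g n (z + X i) + e n)"
    using insert.IH Z insert.prems by blast
  then obtain e where e: "\<And>i. e i \<longlonglongrightarrow> 0"
      "\<And>i n. ?S n (z + X i) \<le> a n ^ card T * g n (z + X i) + e i n"
    using choice[of "\<lambda>i e. e \<longlonglongrightarrow> 0 \<and> (\<forall>n. ?S n (z + X i) \<le> a n ^ card T * g n (z + X i) + e n)"]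
    by blast
  obtain e0 where e0: "e0 \<longlonglongrightarrow> 0"
      "\<And>n. (\<Sum>i\<in>UNIV. p i * g n (z + X i)) \<le> a n * g n z + e0 n"
    using step[OF insert.prems] by blast
  \<comment> \<open>The error of the first draw is amplified by the remaining factors, and the
    errors of the later draws are averaged. Convergence of \<open>a\<close> keeps the amplification
    bounded.\<close>
  define e' where "e' n = a n ^ card T * e0 n + (\<Sum>i\<in>UNIV. p i * e i n)" for n
  have "e' \<longlonglongrightarrow> a' ^ card T * 0 + (\<Sum>i\<in>UNIV. p i * 0)"
    unfolding e'_def by (intro tendsto_intros a e0 e)
  then have "e' \<longlonglongrightarrow> 0" by simp
  moreover have "(\<Sum>f\<in>PiE (insert t T) (\<lambda>_. UNIV). (\<Prod>t\<in>insert t T. p (f t)) *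
      g n (z + (\<Sum>t\<in>insert t T. X (f t)))) \<le> a n ^ card (insert t T) * g n z + e' n" for n
  proof -
    have upd: "(\<Sum>j\<in>T. X (if j = t then i else f j)) = (\<Sum>j\<in>T. X (f j))" for i f
      using insert.hyps by (intro sum.cong) auto
    have "(\<Sum>f\<in>PiE (insert t T) (\<lambda>_. UNIV). (\<Prod>t\<in>insert t T. p (f t)) *
        g n (z + (\<Sum>t\<in>insert t T. X (f t)))) = (\<Sum>i\<in>UNIV. p i * ?S n (z + X i))"
      using insert.hyps
      by (subst sum_PiE_insert) (simp_all add: upd add.assoc)
    also have "\<dots> \<le> (\<Sum>i\<in>UNIV. p i * (a n ^ card T * g n (z + X i) + e i n))"
      by (intro sum_mono mult_left_mono e p)
    also have "\<dots> = a n ^ card T * (\<Sum>i\<in>UNIV. p i * g n (z + X i)) + (\<Sum>i\<in>UNIV. p i * e i n)"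
      by (simp add: algebra_simps sum.distrib sum_distrib_left)
    also have "\<dots> \<le> a n ^ card T * (a n * g n z + e0 n) + (\<Sum>i\<in>UNIV. p i * e i n)"
      by (intro add_right_mono mult_left_mono e0 zero_le_power a)
    also have "\<dots> = a n ^ card (insert t T) * g n z + e' n"
      using insert.hyps by (simp add: e'_def algebra_simps)
    finally show ?thesis .
  qed
  ultimately show ?case by blast
qed

text \<open>Without the vanishing odd terms, cosh becomes a power series in the square of its
  argument, the form suited to squared norms.\<close>

lemma cosh_sums_even: "(\<lambda>n. x ^ (2 * n) / fact (2 * n)) sums cosh x" for x :: real
proof -
  let ?f = "\<lambda>n. if even n then x ^ n /\<^sub>R fact n else 0"
  have "strict_mono (\<lambda>n::nat. 2 * n)"
    by (simp add: strict_mono_def)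
  moreover have "?f n = 0" if "n \<notin> range (\<lambda>n. 2 * n)" for n
    using that by (auto elim!: evenE)
  ultimately have "(\<lambda>n. ?f (2 * n)) sums cosh x"
    using cosh_converges[of x] sums_mono_reindex[of "\<lambda>n. 2 * n" ?f] by blast
  then show ?thesis
    by (simp add: divide_inverse mult.commute)
qed

lemma sinh_ge_self: "x \<le> sinh x" if "0 \<le> x" for x :: real
proof -
  have "\<exists>d. ((\<lambda>y. sinh y - y) has_real_derivative d) (at y) \<and> 0 \<le> d" for y :: real
    by (rule exI[of _ "cosh y - 1"]) (auto intro!: derivative_eq_intros simp: cosh_real_ge_1)
  then show ?thesis
    using DERIV_nonneg_imp_nondecreasing[OF that, of "\<lambda>y. sinh y - y"] by simp
qed

text \<open>Convexity of the power function. In the induction step the defect is s (1 - s) (x - y)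
  (x^n - y^n), whose last two factors have equal sign.\<close>

lemma power_convex_combination:
  fixes s x y :: real
  assumes "0 \<le> s" "s \<le> 1" "0 \<le> x" "0 \<le> y"
  shows "(s * x + (1 - s) * y) ^ n \<le> s * x ^ n + (1 - s) * y ^ n"
proof (induction n)
  case (Suc n)
  have "(s * x + (1 - s) * y) ^ Suc n \<le> (s * x + (1 - s) * y) * (s * x ^ n + (1 - s) * y ^ n)"
    using assms by (simp add: mult_left_mono Suc)
  moreover have "0 \<le> (s * (1 - s)) * ((x - y) * (x ^ n - y ^ n))"
  proof (rule mult_nonneg_nonneg)
    show "0 \<le> (x - y) * (x ^ n - y ^ n)"
      using assms power_mono[of x y n] power_mono[of y x n]
      by (cases "x \<le> y") (auto intro: mult_nonneg_nonneg mult_nonpos_nonpos)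
  qed (use assms in auto)
  ultimately show ?case
    by (simp add: algebra_simps)
qed auto

text \<open>The one-step estimate behind Pinelis' inequality. With a = |x|, b = |y| and
  \<open>c\<close> the cosine of the angle, |x + y|^2 is the average of (a + b)^2 and (a - b)^2 with
  weights (1 + c) / 2 and (1 - c) / 2. The term linear in \<open>y\<close> is kept apart so that it
  vanishes for centred \<open>y\<close>.\<close>

lemma cosh_norm_add_le:
  fixes x y :: "'a::real_inner"
  shows "cosh (norm (x + y)) \<le> cosh (norm x) * (exp (norm y) - norm y) +
    sinh (norm x) / norm x * (x \<bullet> y)"
\<comment> \<open>At x = 0 the quotient is 0 by the division convention and the claim reduces to b
  \<le> sinh b.\<close>
proof (cases "x = 0 \<or> y = 0")
  case True
  then show ?thesis
    using sinh_ge_self[of "norm y"] sinh_plus_cosh[of "norm y"] by fastforce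
next
  case False
  define a b c where "a = norm x" and "b = norm y" and "c = x \<bullet> y / (norm x * norm y)"
  have ab: "0 < a" "0 < b" using False by (auto simp: a_def b_def)
  have xy: "x \<bullet> y = a * b * c" using False by (simp add: a_def b_def c_def)
  have c: "\<bar>c\<bar> \<le> 1"
    using Cauchy_Schwarz_ineq2[of x y] ab by (simp add: c_def a_def b_def divide_simps abs_mult)
  define s where "s = (1 + c) / 2"
  have s: "0 \<le> s" "s \<le> 1" using c by (auto simp: s_def)
  have sq: "(norm (x + y))\<^sup>2 = s * (a + b)\<^sup>2 + (1 - s) * (a - b)\<^sup>2"
  proof -
    have "(norm (x + y))\<^sup>2 = a\<^sup>2 + b\<^sup>2 + 2 * (a * b * c)"
      unfolding xy [symmetric]
      by (simp add: a_def b_def power2_norm_eq_inner inner_add_left inner_add_right inner_commute)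
    then show ?thesis
      by (simp add: s_def power2_eq_square field_simps)
  qed
  txt \<open>\<open>cosh (sqrt z)\<close> has a power series in \<open>z\<close> with nonnegative coefficients, hence is convex.\<close>
  have "cosh (norm (x + y)) \<le> s * cosh (a + b) + (1 - s) * cosh (a - b)"
  proof (rule sums_le)
    show "(\<lambda>n. norm (x + y) ^ (2 * n) / fact (2 * n)) sums cosh (norm (x + y))"
      by (rule cosh_sums_even)
    show "(\<lambda>n. s * ((a + b) ^ (2 * n) / fact (2 * n)) + (1 - s) * ((a - b) ^ (2 * n) / fact (2 * n)))
        sums (s * cosh (a + b) + (1 - s) * cosh (a - b))"
      by (intro sums_add sums_mult cosh_sums_even)
    show "norm (x + y) ^ (2 * n) / fact (2 * n) \<le>
        s * ((a + b) ^ (2 * n) / fact (2 * n)) + (1 - s) * ((a - b) ^ (2 * n) / fact (2 * n))" for n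
      using power_convex_combination[OF s zero_le_power2 zero_le_power2, of "a + b" "a - b" n]
      by (simp add: power_mult sq divide_right_mono flip: add_divide_distrib)
  qed
  also have "\<dots> = cosh a * cosh b + c * sinh a * sinh b"
    by (simp add: s_def cosh_add cosh_diff field_simps)
  \<comment> \<open>Writing sinh b = b + (sinh b - b) isolates the linear part; the nonnegative
    remainder loses its factor c sinh a to cosh a.\<close>
  also have "\<dots> \<le> cosh a * (exp b - b) + sinh a / a * (a * b * c)"
  proof -
    have "c * sinh a * (sinh b - b) \<le> 1 * cosh a * (sinh b - b)"
    proof (intro mult_right_mono)
      have "c * sinh a \<le> 1 * sinh a" using c ab by (intro mult_right_mono) auto
      then show "c * sinh a \<le> 1 * cosh a" using sinh_le_cosh_real[of a] by linarith
      show "0 \<le> sinh b - b" using sinh_ge_self[of b] ab by simp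
    qed
    then show ?thesis
      using ab by (simp add: sinh_plus_cosh[symmetric] algebra_simps)
  qed
  finally show ?thesis unfolding xy by (simp add: a_def b_def)
qed

text \<open>Bernstein's comparison of the exponential series with a geometric one of ratio u / 3, by
  (n + 2)! \<ge> 2 * 3^n.\<close>

lemma exp_minus_linear_le:
  fixes u :: real
  assumes "0 \<le> u" "u < 3"
  shows "exp u - u \<le> 1 + u\<^sup>2 / (2 * (1 - u / 3))"
proof -
  have fact: "2 * 3 ^ n \<le> (fact (n + 2) :: real)" for n
  proof (induction n)
    case (Suc n)
    have "2 * 3 ^ Suc n \<le> 3 * (fact (n + 2) :: real)"
      using Suc by (simp del: fact_Suc add_2_eq_Suc')
    also have "\<dots> \<le> fact (Suc n + 2)"
      using mult_right_mono[of 3 "real n + 3" "fact (n + 2)"] by (simp add: algebra_simps)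
    finally show ?case .
  qed simp
  have "(\<lambda>n. u ^ n /\<^sub>R fact n) sums exp u"
    by (rule exp_converges)
  then have "(\<lambda>n. u ^ (n + 2) /\<^sub>R fact (n + 2)) sums (exp u - (\<Sum>n<2. u ^ n /\<^sub>R fact n))"
    by (rule sums_split_initial_segment)
  moreover have "(\<lambda>n. u\<^sup>2 / 2 * (u / 3) ^ n) sums (u\<^sup>2 / 2 * (1 / (1 - u / 3)))"
    using assms by (intro sums_mult geometric_sums) auto
  ultimately have "exp u - (\<Sum>n<2. u ^ n /\<^sub>R fact n) \<le> u\<^sup>2 / 2 * (1 / (1 - u / 3))"
  proof (rule sums_le[rotated])
    show "u ^ (n + 2) /\<^sub>R fact (n + 2) \<le> u\<^sup>2 / 2 * (u / 3) ^ n" for n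
    proof -
      have "u ^ (n + 2) /\<^sub>R fact (n + 2) \<le> u ^ (n + 2) / (2 * 3 ^ n)"
        unfolding real_scaleR_def divide_inverse_commute[symmetric]
        using assms by (intro frac_le fact) auto
      also have "\<dots> = u\<^sup>2 / 2 * (u / 3) ^ n"
        by (simp add: power_divide power_add power2_eq_square)
      finally show ?thesis .
    qed
  qed
  then show ?thesis by (simp add: eval_nat_numeral)
qed

text \<open>Markov's inequality for cosh (l |z|), which grows in mean by at most the factor
  \<open>a\<close> per draw. The prefactor 2 comes from cosh x \<ge> exp x / 2.\<close>

lemma vector_bernstein:
  fixes p :: "'i::finite \<Rightarrow> real" and X :: "'i \<Rightarrow> 'b::real_inner"
  assumes p: "\<And>i. 0 \<le> p i" "(\<Sum>i\<in>UNIV. p i) = 1"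
    and mean: "(\<Sum>i\<in>UNIV. p i *\<^sub>R X i) = 0"
    and R: "\<And>i. norm (X i) \<le> R"
    and T: "finite T"
    and v: "real (card T) * (\<Sum>i\<in>UNIV. p i * (norm (X i))\<^sup>2) \<le> v" "0 < v"
    and r: "0 < r"
  shows "(\<Sum>f\<in>{f \<in> PiE T (\<lambda>_. UNIV). r < norm (\<Sum>t\<in>T. X (f t))}. \<Prod>t\<in>T. p (f t))
    \<le> 2 * exp (- r\<^sup>2 / (2 * (v + R * r / 3)))"
proof -
  \<comment> \<open>Bernstein's choice: then 1 - l R / 3 = v / (v + R r / 3), the growth over all
    draws is at most exp (l r / 2), and the exponent becomes l r / 2 - l r = - l r / 2.\<close>
  define l where "l = r / (v + R * r / 3)"
  define V where "V = (\<Sum>i\<in>UNIV. p i * (norm (X i))\<^sup>2)"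
  define a where "a = 1 + l\<^sup>2 * V / (2 * (1 - l * R / 3))"
  have R0: "0 \<le> R" using R norm_ge_zero order_trans by blast
  have den: "0 < v + R * r / 3" using v r R0 by (simp add: add_pos_nonneg)
  have l: "0 < l" using r den by (simp add: l_def)
  have lR: "1 - l * R / 3 = v / (v + R * r / 3)"
    using den by (simp add: l_def field_simps)
  then have lR': "0 < 1 - l * R / 3" using v den by simp
  have V: "0 \<le> V" unfolding V_def by (intro sum_nonneg mult_nonneg_nonneg p) auto
  have a0: "0 \<le> a" unfolding a_def using V lR'
    by (intro add_nonneg_nonneg divide_nonneg_pos mult_nonneg_nonneg) (auto simp: mult.commute)
  let ?g = "\<lambda>(n::nat) (z::'b). cosh (l * norm z)"
  have step: "(\<Sum>i\<in>UNIV. p i * ?g n (z + X i)) \<le> a * ?g n z" for n :: nat and z :: 'b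
  proof -
    let ?s = "sinh (l * norm z) / (l * norm z)"
    have "?g n (z + X i) \<le> ?g n z * (1 + l\<^sup>2 * (norm (X i))\<^sup>2 / (2 * (1 - l * R / 3))) +
        ?s * l\<^sup>2 * (z \<bullet> X i)" for i
    proof -
      let ?u = "l * norm (X i)"
      have u: "0 \<le> ?u" "?u \<le> l * R"
        using l R by auto
      have "?g n (z + X i) = cosh (norm (l *\<^sub>R z + l *\<^sub>R X i))"
        using l by (simp flip: scaleR_add_right)
      also have "\<dots> \<le> cosh (norm (l *\<^sub>R z)) * (exp (norm (l *\<^sub>R X i)) - norm (l *\<^sub>R X i)) +
          sinh (norm (l *\<^sub>R z)) / norm (l *\<^sub>R z) * (l *\<^sub>R z \<bullet> l *\<^sub>R X i)"
        by (rule cosh_norm_add_le)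
      also have "\<dots> = ?g n z * (exp ?u - ?u) + ?s * l\<^sup>2 * (z \<bullet> X i)"
        using l by (simp add: power2_eq_square)
      also have "exp ?u - ?u \<le> 1 + l\<^sup>2 * (norm (X i))\<^sup>2 / (2 * (1 - l * R / 3))"
      proof -
        have "exp ?u - ?u \<le> 1 + ?u\<^sup>2 / (2 * (1 - ?u / 3))"
          using u lR' by (intro exp_minus_linear_le) auto
        also have "\<dots> \<le> 1 + ?u\<^sup>2 / (2 * (1 - l * R / 3))"
          using u lR' by (intro add_left_mono divide_left_mono mult_pos_pos) auto
        finally show ?thesis by (simp add: power_mult_distrib)
      qed
      finally show ?thesis by (simp add: mult_left_mono)
    qed
    then have "(\<Sum>i\<in>UNIV. p i * ?g n (z + X i)) \<le> (\<Sum>i\<in>UNIV. p i *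
        (?g n z * (1 + l\<^sup>2 * (norm (X i))\<^sup>2 / (2 * (1 - l * R / 3))) + ?s * l\<^sup>2 * (z \<bullet> X i)))"
      by (intro sum_mono mult_left_mono p)
    \<comment> \<open>The coefficient of the linear term does not depend on \<open>i\<close>, so
      averaging leaves the inner product of \<open>z\<close> with the mean of \<open>X\<close>,
      which is 0.\<close>
    also have "\<dots> = ?g n z * ((\<Sum>i\<in>UNIV. p i) + l\<^sup>2 / (2 * (1 - l * R / 3)) * V) +
        ?s * l\<^sup>2 * (z \<bullet> (\<Sum>i\<in>UNIV. p i *\<^sub>R X i))"
      by (simp add: V_def inner_sum_right sum_distrib_left sum_distrib_right sum.distrib
          sum_divide_distrib algebra_simps)
    also have "\<dots> = a * ?g n z"
      by (simp add: mean p a_def)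
    finally show ?thesis .
  qed
  let ?w = "\<lambda>f. \<Prod>t\<in>T. p (f t)" and ?S = "\<lambda>f. \<Sum>t\<in>T. X (f t)"
  \<comment> \<open>The one-step bound is exact here: \<open>a\<close> and \<open>?g\<close> are
    constant in \<open>n\<close> and the one-step error is 0.\<close>
  have "\<exists>e. e \<longlonglongrightarrow> 0 \<and> (\<forall>n. (\<Sum>f\<in>PiE T (\<lambda>_. UNIV). ?w f * ?g n (0 + ?S f)) \<le>
      a ^ card T * ?g n 0 + e n)"
  proof (rule random_sum_drift[where Z = UNIV and a' = a])
    show "\<exists>e. e \<longlonglongrightarrow> 0 \<and> (\<forall>n. (\<Sum>i\<in>UNIV. p i * ?g n (z + X i)) \<le> a * ?g n z + e n)" for z
      using step by (intro exI[of _ "\<lambda>_. 0"]) auto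
  qed (use p a0 T in auto)
  then obtain e where e: "e \<longlonglongrightarrow> 0"
      "\<And>n::nat. (\<Sum>f\<in>PiE T (\<lambda>_. UNIV). ?w f * cosh (l * norm (?S f))) \<le> a ^ card T + e n"
    by auto
  have "(\<lambda>n. a ^ card T + e n) \<longlonglongrightarrow> a ^ card T + 0"
    by (intro tendsto_intros e)
  then have E: "(\<Sum>f\<in>PiE T (\<lambda>_. UNIV). ?w f * cosh (l * norm (?S f))) \<le> a ^ card T"
    using LIMSEQ_le_const e(2) by fastforce
  have "a ^ card T \<le> exp (l\<^sup>2 * V / (2 * (1 - l * R / 3))) ^ card T"
    using a0 unfolding a_def by (intro power_mono exp_ge_add_one_self) auto
  also have "\<dots> = exp (l\<^sup>2 * (real (card T) * V) / (2 * (1 - l * R / 3)))"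
    by (simp add: exp_of_nat_mult[symmetric] mult_ac)
  also have "\<dots> \<le> exp (l\<^sup>2 * v / (2 * (1 - l * R / 3)))"
    using v lR' unfolding V_def by (intro iffD2[OF exp_le_cancel_iff] divide_right_mono mult_left_mono) (auto simp: mult.commute)
  also have "l\<^sup>2 * v / (2 * (1 - l * R / 3)) = l * r / 2"
  proof -
    have "(r / d)\<^sup>2 * v / (2 * (v / d)) = r / d * r / 2" if "0 < d" for d
      using that v by (simp add: power2_eq_square field_simps)
    from this[OF den] show ?thesis
      unfolding lR unfolding l_def .
  qed
  finally have a: "a ^ card T \<le> exp (l * r / 2)" .
  let ?B = "{f \<in> PiE T (\<lambda>_. UNIV). r < norm (?S f)}"
  have fin: "finite (PiE T (\<lambda>_. UNIV :: 'i set))" using T by (intro finite_PiE) auto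
  have "(\<Sum>f\<in>?B. ?w f) * (exp (l * r) / 2) \<le> (\<Sum>f\<in>?B. ?w f * cosh (l * norm (?S f)))"
    unfolding sum_distrib_right
  proof (intro sum_mono mult_left_mono prod_nonneg)
    fix f assume f: "f \<in> ?B"
    have "exp (l * r) \<le> exp (l * norm (?S f))" using f l by simp
    then show "exp (l * r) / 2 \<le> cosh (l * norm (?S f))"
      unfolding cosh_field_def by (intro divide_right_mono add_increasing2) auto
  qed (use p in auto)
  also have "\<dots> \<le> (\<Sum>f\<in>PiE T (\<lambda>_. UNIV). ?w f * cosh (l * norm (?S f)))"
    using p by (intro sum_mono2 fin mult_nonneg_nonneg prod_nonneg) auto
  also have "\<dots> \<le> exp (l * r / 2)" using E a by linarith
  finally have "(\<Sum>f\<in>?B. ?w f) \<le> exp (l * r / 2) / (exp (l * r) / 2)"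
    by (simp add: field_simps)
  also have "\<dots> = 2 * exp (l * r / 2 - l * r)"
    unfolding exp_diff by simp
  also have "l * r / 2 - l * r = - r\<^sup>2 / (2 * (v + R * r / 3))"
  proof -
    have "r / d * r / 2 - r / d * r = - r\<^sup>2 / (2 * d)" for d
      by (simp add: power2_eq_square)
    from this[of "v + R * r / 3"] show ?thesis
      unfolding l_def .
  qed
  finally show ?thesis .
qed

section \<open>A matrix Chernoff bound\<close>

text \<open>Squaring replaces \<open>a\<close> by a (2 - a |y|^2), which squares x = 1 - a |y|^2;
  the sum of x^j over j < 2 N is 1 + x times the sum of x^(2 j) over j < N. The geometric sum avoids
  a division by |y|^2, which may be 0.\<close>

lemma pow2_projection_minus_outer:
  fixes P :: "real^'n^'n"
  assumes P: "transpose P = P" "P ** P = P" "P *v y = y"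
  shows "pow2 n (P - a *\<^sub>R outer y y) =
    P - (a * (\<Sum>j<2 ^ n. (1 - a * (norm y)\<^sup>2) ^ j)) *\<^sub>R outer y y"
proof (induction n arbitrary: a)
  case 0
  then show ?case by simp
next
  case (Suc n)
  let ?s = "(norm y)\<^sup>2" and ?Y = "outer y y"
  have yy: "?Y ** ?Y = ?s *\<^sub>R ?Y" "P ** ?Y = ?Y" "?Y ** P = ?Y"
    by (simp_all add: mult_outer outer_mult_vector outer_mult P outer_scaleR_left power2_norm_eq_inner
        del: transpose_matrix_vector)
  have "(P - a *\<^sub>R ?Y) ** (P - a *\<^sub>R ?Y) = P - (a * (2 - a * ?s)) *\<^sub>R ?Y"
    by (simp add: matmul.diff_left matmul.diff_right matmul.scaleR_left matmul.scaleR_right yy P)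
       (simp add: vec_eq_iff algebra_simps)
  then have "pow2 (Suc n) (P - a *\<^sub>R ?Y) = P - (a * (2 - a * ?s) *
      (\<Sum>j<2 ^ n. (1 - a * (2 - a * ?s) * ?s) ^ j)) *\<^sub>R ?Y"
    by (simp only: pow2.simps Suc.IH)
  moreover have "(2 - a * ?s) * (\<Sum>j<2 ^ n. (1 - a * (2 - a * ?s) * ?s) ^ j) =
      (\<Sum>j<2 ^ Suc n. (1 - a * ?s) ^ j)"
  proof -
    define x where "x = 1 - a * ?s"
    have sq: "1 - a * (2 - a * ?s) * ?s = x\<^sup>2"
      by (simp add: x_def power2_eq_square algebra_simps)
    have dbl: "(\<Sum>j<2 * N. x ^ j) = (1 + x) * (\<Sum>j<N. (x\<^sup>2) ^ j)" for N
      by (induction N) (simp_all add: algebra_simps power2_eq_square power_mult_distrib power_add mult_2_right)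
    have "2 - a * ?s = 1 + x"
      by (simp add: x_def)
    then show ?thesis
      unfolding sq x_def [symmetric] using dbl[of "2 ^ n"] by simp
  qed
  ultimately show ?case by (simp add: mult.assoc)
qed

text \<open>Jensen's inequality for the spectral measure of \<open>K\<close> at \<open>x\<close>,
  obtained by iterating the Cauchy-Schwarz bound (x . K x)^2 \<le> |K x|^2 = x . K K x.\<close>

lemma inner_pow2_ge:
  fixes K :: "real^'n^'n"
  assumes "transpose K = K" "norm x = 1"
  shows "(x \<bullet> (K *v x)) ^ (2 ^ n) \<le> x \<bullet> (pow2 n K *v x)"
  using assms(1)
proof (induction n arbitrary: K)
  case 0
  then show ?case by simp
next
  case (Suc n)
  have KK: "x \<bullet> (K ** K *v x) = (norm (K *v x))\<^sup>2"
    using inner_symmetric_matrix[OF Suc.prems, of x "K *v x"]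
    by (simp add: power2_norm_eq_inner matrix_vector_mul_assoc)
  have "\<bar>x \<bullet> (K *v x)\<bar> \<le> norm (K *v x)"
    using Cauchy_Schwarz_ineq2[of x "K *v x"] assms(2) by simp
  then have "(x \<bullet> (K *v x))\<^sup>2 \<le> x \<bullet> (K ** K *v x)"
    unfolding KK by (metis abs_norm_cancel abs_le_square_iff)
  then have "((x \<bullet> (K *v x))\<^sup>2) ^ (2 ^ n) \<le> (x \<bullet> (K ** K *v x)) ^ (2 ^ n)"
    by (intro power_mono) auto
  also have "\<dots> \<le> x \<bullet> (pow2 n (K ** K) *v x)"
    by (intro Suc.IH) (simp add: matrix_transpose_mul Suc.prems)
  finally show ?case
    by (simp add: power_mult)
qed

text \<open>An even power of a symmetric matrix is a square, so its quadratic form is nonnegative.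
  This is the reason for the exponents 2^(n + 1) in the Chernoff bound.\<close>

lemma inner_pow2_Suc:
  fixes K :: "real^'n^'n"
  assumes "transpose K = K"
  shows "x \<bullet> (pow2 (Suc n) K *v x) = (norm (pow2 n K *v x))\<^sup>2"
  using inner_symmetric_matrix[of "pow2 n K" x "pow2 n K *v x"]
  by (simp add: pow2_Suc transpose_pow2 assms matrix_vector_mul_assoc power2_norm_eq_inner del: pow2.simps)

lemma trace_pow2_Suc:
  fixes K :: "real^'n^'n"
  assumes "transpose K = K"
  shows "trace (pow2 (Suc n) K) = (norm (pow2 n K))\<^sup>2"
  by (simp add: norm_matrix_square transpose_pow2 assms pow2_Suc del: pow2.simps)

text \<open>One direction bounds the trace from below: the form of an even power at a unit vector is
  a squared length, dominated by the squared Frobenius norm, which is the trace.\<close>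

lemma trace_pow2_Suc_ge:
  fixes K :: "real^'n^'n"
  assumes K: "transpose K = K" and x: "norm x = 1"
  shows "(x \<bullet> (K *v x)) ^ (2 ^ Suc n) \<le> trace (pow2 (Suc n) K)"
proof -
  have "(x \<bullet> (K *v x)) ^ (2 ^ Suc n) \<le> (norm (pow2 n K *v x))\<^sup>2"
    using inner_pow2_ge[OF K x, of "Suc n"] unfolding inner_pow2_Suc[OF K] .
  also have "\<dots> \<le> (norm (pow2 n K))\<^sup>2"
    using norm_matrix_vector_mult_le[of "pow2 n K" x] x by (intro power_mono) auto
  finally show ?thesis
    by (simp only: trace_pow2_Suc[OF K])
qed

lemma pow2_mult_absorb: "K ** P = K \<Longrightarrow> pow2 n K ** P = pow2 n K"
proof (induction n arbitrary: K)
  case (Suc n)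
  have "K ** K ** P = K ** K"
    using Suc.prems by (metis matrix_mul_assoc)
  then show ?case
    by (simp add: Suc.IH)
qed auto

text \<open>A discrete Lie-Trotter formula. With N = 2^n the two bases differ by X Y / N^2, so their
  N-th powers differ by O(1 / N).\<close>

lemma trace_pow2_product_limit:
  fixes P X Y :: "real^'n^'n"
  assumes P: "P ** P = P" "vbound P 1" and X: "X ** P = X" and Y: "P ** Y = Y"
  shows "(\<lambda>n. trace (pow2 n (P - (1 / 2 ^ n) *\<^sub>R (X + Y))) -
    trace (pow2 n ((P - (1 / 2 ^ n) *\<^sub>R X) ** (P - (1 / 2 ^ n) *\<^sub>R Y)))) \<longlonglongrightarrow> 0"
    (is "?d \<longlonglongrightarrow> 0")
proof -
  \<comment> \<open>Chosen so that both bases have operator norm at most 1 + C / N, whose N-th power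
    is at most exp C.\<close>
  define C where "C = norm X + norm Y + norm X * norm Y"
  define D where "D = real CARD('n) * (norm (X ** Y) * exp C)"
  have C: "0 \<le> C" by (simp add: C_def)
  have bound: "\<bar>?d n\<bar> \<le> D * (1 / 2) ^ n" for n
  proof -
    define N :: nat where "N = 2 ^ n"
    define e :: real where "e = 1 / 2 ^ n"
    have N: "0 < N" by (simp add: N_def)
    have e: "0 < e" "e \<le> 1" and eN: "e = 1 / real N" by (simp_all add: e_def N_def)
    let ?b = "1 + e * C"
    have PX: "vbound (P - e *\<^sub>R Z) (1 + e * norm Z)" for Z
      using vbound_add[OF P(2) vbound_norm[of "- (e *\<^sub>R Z)"]] e by simp
    have 1: "vbound (P - e *\<^sub>R (X + Y)) ?b"
      using norm_triangle_ineq[of X Y] e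
      by (intro vbound_mono[OF PX]) (simp add: C_def add_increasing2)
    have 2: "vbound ((P - e *\<^sub>R X) ** (P - e *\<^sub>R Y)) ?b"
    proof (rule vbound_mono[OF vbound_mult[OF PX PX]])
      have "e * (e * (norm X * norm Y)) \<le> e * (1 * (norm X * norm Y))"
        using e by (intro mult_left_mono mult_right_mono) auto
      then show "(1 + e * norm X) * (1 + e * norm Y) \<le> ?b"
        by (simp add: C_def algebra_simps)
    qed
    have "(P - e *\<^sub>R (X + Y)) - (P - e *\<^sub>R X) ** (P - e *\<^sub>R Y) = - ((e * e) *\<^sub>R (X ** Y))"
      by (simp add: matmul.diff_left matmul.diff_right matmul.scaleR_left matmul.scaleR_right P X Y
          scaleR_add_right scaleR_diff_right)
    then have 3: "vbound ((P - e *\<^sub>R (X + Y)) - (P - e *\<^sub>R X) ** (P - e *\<^sub>R Y))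
        (e * e * norm (X ** Y))"
      using vbound_norm[of "- ((e * e) *\<^sub>R (X ** Y))"] by simp
    have "\<bar>?d n\<bar> \<le> real CARD('n) * (2 ^ n * (e * e * norm (X ** Y)) * ?b ^ (2 ^ n - 1))"
      using abs_trace_le[OF vbound_pow2_diff[OF 1 2 3, of n]] by (simp add: trace_sub e_def)
    also have "\<dots> = real CARD('n) * (e * norm (X ** Y) * ?b ^ (N - 1))"
      by (simp add: e_def N_def)
    also have "\<dots> \<le> real CARD('n) * (e * norm (X ** Y) * exp C)"
    proof (intro mult_left_mono)
      have "?b ^ (N - 1) \<le> ?b ^ N"
        using e C by (intro power_increasing) auto
      also have "\<dots> \<le> exp C"
        using exp_ge_one_plus_x_over_n_power_n[of N C] N C by (simp add: eN)
      finally show "?b ^ (N - 1) \<le> exp C" .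
    qed (use e in auto)
    also have "\<dots> = D * (1 / 2) ^ n"
      by (simp add: D_def e_def power_divide)
    finally show ?thesis .
  qed
  have "(\<lambda>n. D * (1 / 2) ^ n) \<longlonglongrightarrow> D * 0"
    by (intro tendsto_intros LIMSEQ_realpow_zero) auto
  then have lim: "(\<lambda>n. D * (1 / 2) ^ n) \<longlonglongrightarrow> 0"
    by (simp only: mult_zero_right)
  show ?thesis
    by (rule Lim_null_comparison[OF _ lim], rule always_eventually) (use bound in simp)
qed

lemma power_exp_limit: "(\<lambda>n. (1 - c / 2 ^ Suc n) ^ (2 ^ Suc n)) \<longlonglongrightarrow> exp (- c)" for c :: real
proof -
  have "filterlim (\<lambda>n. 2 ^ Suc n :: nat) sequentially sequentially"
    by (rule filterlim_subseq) (simp add: strict_mono_def)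
  from filterlim_compose[OF tendsto_exp_limit_sequentially[of "- c"] this]
  show ?thesis by simp
qed

text \<open>Markov's inequality for the trace of (P - \<theta> G / N)^N, G being the sum of the
  outer squares, as a substitute for exp (- \<theta> G) on the range of \<open>P\<close>. Each draw
  contracts it in mean by \<open>a n\<close>, up to a vanishing error, whereas a bad outcome makes
  it at least (1 - \<tau> / N)^N.\<close>

lemma matrix_chernoff_lower:
  fixes p :: "'i::finite \<Rightarrow> real" and y :: "'i \<Rightarrow> real^'n" and P :: "real^'n^'n"
    and R \<mu> :: real
  assumes p: "\<And>i. 0 \<le> p i" "(\<Sum>i\<in>UNIV. p i) = 1"
    and P: "transpose P = P" "P ** P = P"
    and y: "\<And>i. P *v y i = y i" "\<And>i. (norm (y i))\<^sup>2 \<le> R" "0 < R"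
    and mean: "(\<Sum>i\<in>UNIV. p i *\<^sub>R outer (y i) (y i)) = \<mu> *\<^sub>R P" "0 \<le> \<mu>"
    and T: "finite T"
  defines "bad \<equiv> {f \<in> PiE T (\<lambda>_. UNIV). \<exists>x. P *v x = x \<and> norm x = 1 \<and>
      x \<bullet> ((\<Sum>t\<in>T. outer (y (f t)) (y (f t))) *v x) \<le> card T * \<mu> / 2}"
  shows "(\<Sum>f\<in>bad. \<Prod>t\<in>T. p (f t)) \<le> trace P * exp (- (card T * \<mu> / (8 * R)))"
proof -
  \<comment> \<open>The minimizer of the limiting exponent when the threshold is half the mean: it
    solves exp (- \<theta> R) = 1/2.\<close>
  define \<theta> where "\<theta> = ln 2 / R"
  have \<theta>: "0 < \<theta>" using y(3) by (simp add: \<theta>_def)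
  define X where "X i = \<theta> *\<^sub>R outer (y i) (y i)" for i
  define h where "h n z = P - (1 / 2 ^ Suc n) *\<^sub>R z" for n :: nat and z
  define g where "g n z = trace (pow2 (Suc n) (h n z))" for n z
  \<comment> \<open>The symmetric matrices living on the range of \<open>P\<close>; all partial sums
    stay there.\<close>
  define Z where "Z = {z. transpose z = z \<and> P ** z = z}"
  \<comment> \<open>The discrete counterpart of (1 - exp (- \<theta> R)) / R, with limit 1 / (2
    R).\<close>
  define \<beta> where "\<beta> n = (1 - (1 - ln 2 / 2 ^ Suc n) ^ (2 ^ Suc n)) / R" for n
  txt \<open>The maximum with 0 covers the degenerate case \<open>P = 0\<close>, where \<open>\<mu>\<close> is unconstrained.\<close>
  define a where "a n = max 0 (1 - \<mu> * \<beta> n)" for n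
  define a' where "a' = max 0 (1 - \<mu> * ((1 - exp (- ln 2)) / R))"
  have X: "transpose (X i) = X i" "P ** X i = X i" for i
    by (simp_all add: X_def transpose_scalar transpose_outer matmul.scaleR_right mult_outer y)
  have ZP: "z ** P = z" if "z \<in> Z" for z
    using that P(1) unfolding Z_def by (metis (mono_tags, lifting) matrix_transpose_mul mem_Collect_eq)
  have Zadd: "z + X i \<in> Z" if "z \<in> Z" for z i
    using that X by (simp add: Z_def transpose_add matmul.add_right)
  have XZ: "X i \<in> Z" for i
    using X by (simp add: Z_def)
  have hsym: "transpose (h n z) = h n z" if "z \<in> Z" for n z
    using that P by (simp add: h_def Z_def transpose_diff transpose_scalar)
  have hP: "h n z ** P = h n z" if "z \<in> Z" for n z
    using that P by (simp add: h_def matmul.diff_left matmul.scaleR_left ZP)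
  have vP: "vbound P 1"
    using norm_projection_le[OF P] by (simp add: vbound_def)
  have gnonneg: "0 \<le> g n z" if "z \<in> Z" for n z
    unfolding g_def trace_pow2_Suc[OF hsym[OF that]] by simp
  have alim: "a \<longlonglongrightarrow> a'"
    unfolding a_def a'_def \<beta>_def using y(3)
    by (intro tendsto_intros power_exp_limit) auto

  \<comment> \<open>The power of the rank-one factor is explicitly P - b y y^T. From |y|^2 \<le> R
    each term of the geometric sum is at least its value at \<open>R\<close>, so b \<ge> \<beta> n,
    and the quadratic form multiplying \<open>b\<close> is nonnegative.\<close>
  have pow_le: "trace (pow2 (Suc n) (h n z) ** pow2 (Suc n) (h n (X i))) \<le>
      g n z - \<beta> n * (y i \<bullet> (pow2 (Suc n) (h n z) *v y i))" if z: "z \<in> Z" for n z i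
  proof -
    define N :: nat where "N = 2 ^ Suc n"
    define W where "W = pow2 (Suc n) (h n z)"
    have N': "(2::real) ^ Suc n = real N" and "0 < N" by (simp_all add: N_def)
    then have N: "1 \<le> real N" by simp
    define s where "s = (norm (y i))\<^sup>2"
    define b where "b = \<theta> / N * (\<Sum>j<N. (1 - \<theta> / N * s) ^ j)"
    have s: "0 \<le> s" "\<theta> * s \<le> ln 2"
      using y(2)[of i] y(3) \<theta> by (simp_all add: s_def \<theta>_def field_simps)
    have "ln 2 < (1::real)" using ln2_le_25_over_36 by simp
    then have "ln 2 / real N \<le> 1" using N by simp
    moreover have sN: "\<theta> / N * s \<le> ln 2 / N"
      using s N by (simp add: divide_right_mono)
    ultimately have "(\<Sum>j<N. (1 - ln 2 / N) ^ j) \<le> (\<Sum>j<N. (1 - \<theta> / N * s) ^ j)"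
      by (intro sum_mono power_mono) auto
    then have "\<theta> / N * (\<Sum>j<N. (1 - ln 2 / N) ^ j) \<le> b"
      unfolding b_def using \<theta> by (intro mult_left_mono) auto
    moreover have "\<theta> / N * (\<Sum>j<N. (1 - ln 2 / N) ^ j) = \<beta> n"
    proof -
      have "1 - (1 - ln 2 / N) ^ N = ln 2 / N * (\<Sum>j<N. (1 - ln 2 / N) ^ j)"
        using one_diff_power_eq[of "1 - ln 2 / real N" N] by simp
      then show ?thesis
        unfolding \<beta>_def N' N_def [symmetric] by (simp add: \<theta>_def)
    qed
    ultimately have b: "\<beta> n \<le> b" by simp
    have "pow2 (Suc n) (h n (X i)) = P - b *\<^sub>R outer (y i) (y i)"
      using pow2_projection_minus_outer[OF P y(1), of "Suc n" "\<theta> / N" i]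
      unfolding h_def X_def b_def s_def N' N_def [symmetric] by simp
    then have "trace (W ** pow2 (Suc n) (h n (X i))) = trace (W ** P) - b * (y i \<bullet> (W *v y i))"
      by (simp add: matmul.diff_right matmul.scaleR_right trace_sub trace_scaleR mult_outer
          trace_outer inner_commute del: pow2.simps)
    also have "W ** P = W"
      unfolding W_def by (intro pow2_mult_absorb hP z)
    finally have "trace (W ** pow2 (Suc n) (h n (X i))) = g n z - b * (y i \<bullet> (W *v y i))"
      by (simp only: W_def g_def)
    moreover have "\<beta> n * (y i \<bullet> (W *v y i)) \<le> b * (y i \<bullet> (W *v y i))"
      unfolding W_def inner_pow2_Suc[OF hsym[OF z]] by (intro mult_right_mono b) simp
    ultimately show ?thesis unfolding W_def by linarith
  qed

  \<comment> \<open>The increment is split off as a factor at the vanishing cost \<open>d\<close>,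
    the two powers are separated by the trace inequality, and averaging against the mean \<mu> P
    returns the trace itself.\<close>
  have step: "\<exists>e. e \<longlonglongrightarrow> 0 \<and> (\<forall>n. (\<Sum>i\<in>UNIV. p i * g n (z + X i)) \<le> a n * g n z + e n)"
    if z: "z \<in> Z" for z
  proof -
    define d where "d i n = g n (z + X i) - trace (pow2 (Suc n) (h n z ** h n (X i)))" for i n
    have d: "d i \<longlonglongrightarrow> 0" for i
      using LIMSEQ_Suc[OF trace_pow2_product_limit[OF P(2) vP ZP[OF z] X(2), of i]]
      by (simp only: d_def[abs_def] g_def h_def)
    have "(\<lambda>n. \<Sum>i\<in>UNIV. p i * d i n) \<longlonglongrightarrow> (\<Sum>i\<in>UNIV. p i * 0)"
      by (intro tendsto_intros d)
    moreover have "(\<Sum>i\<in>UNIV. p i * g n (z + X i)) \<le> a n * g n z + (\<Sum>i\<in>UNIV. p i * d i n)" for n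
    proof -
      define W where "W = pow2 (Suc n) (h n z)"
      define q where "q i = y i \<bullet> (W *v y i)" for i
      have "g n (z + X i) \<le> g n z - \<beta> n * q i + d i n" for i
        using trace_pow2_mult_le[OF hsym[OF z] hsym[OF XZ], of "Suc n" n n i] pow_le[OF z, of n i]
        unfolding d_def q_def W_def by linarith
      then have "(\<Sum>i\<in>UNIV. p i * g n (z + X i)) \<le> (\<Sum>i\<in>UNIV. p i * (g n z - \<beta> n * q i + d i n))"
        by (intro sum_mono mult_left_mono p)
      also have "\<dots> = (\<Sum>i\<in>UNIV. p i) * g n z - \<beta> n * (\<Sum>i\<in>UNIV. p i * q i) +
          (\<Sum>i\<in>UNIV. p i * d i n)"
        by (simp add: algebra_simps sum.distrib sum_subtractf sum_distrib_left sum_distrib_right)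
      also have "(\<Sum>i\<in>UNIV. p i * q i) = trace (W ** (\<Sum>i\<in>UNIV. p i *\<^sub>R outer (y i) (y i)))"
      proof -
        have tr: "trace (\<Sum>i\<in>I. F i) = (\<Sum>i\<in>I. trace (F i))" for I and F :: "'i \<Rightarrow> real^'n^'n"
          unfolding trace_def sum_component by (rule sum.swap)
        show ?thesis
          by (simp add: q_def matmul.sum_right matmul.scaleR_right mult_outer tr trace_scaleR trace_outer
              inner_commute)
      qed
      also have "\<dots> = \<mu> * g n z"
        unfolding mean(1) matmul.scaleR_right trace_scaleR
        by (simp only: W_def pow2_mult_absorb[OF hP[OF z]] g_def)
      also have "(\<Sum>i\<in>UNIV. p i) * g n z - \<beta> n * (\<mu> * g n z) = (1 - \<mu> * \<beta> n) * g n z"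
        by (simp add: p algebra_simps)
      also have "\<dots> \<le> a n * g n z"
        unfolding a_def using gnonneg[OF z] by (intro mult_right_mono) auto
      finally show ?thesis by simp
    qed
    ultimately show ?thesis
      by (intro exI[of _ "\<lambda>n. \<Sum>i\<in>UNIV. p i * d i n"]) auto
  qed

  let ?w = "\<lambda>f. \<Prod>t\<in>T. p (f t)" and ?S = "\<lambda>f. \<Sum>t\<in>T. X (f t)"
  have "0 \<in> Z" by (simp add: Z_def matmul.zero_right)
  have "\<exists>e. e \<longlonglongrightarrow> 0 \<and> (\<forall>n. (\<Sum>f\<in>PiE T (\<lambda>_. UNIV). ?w f * g n (0 + ?S f)) \<le>
      a n ^ card T * g n 0 + e n)"
    by (rule random_sum_drift[where Z = Z and a' = a', OF p(1) _ alim Zadd step T \<open>0 \<in> Z\<close>])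
       (auto simp: a_def)
  then obtain e where e: "e \<longlonglongrightarrow> 0"
      "\<And>n. (\<Sum>f\<in>PiE T (\<lambda>_. UNIV). ?w f * g n (?S f)) \<le> a n ^ card T * g n 0 + e n"
    by auto
  have g0: "g n 0 = trace P" for n
  proof -
    have "pow2 m P = P" for m by (induction m) (auto simp: P)
    then show ?thesis by (simp only: g_def h_def scaleR_zero_right diff_zero)
  qed
  have SZ: "?S f \<in> Z" for f
    by (simp add: Z_def matmul.sum_right X transpose_sum)
  define \<tau> where "\<tau> = \<theta> * (card T * \<mu> / 2)"
  \<comment> \<open>The condition on \<open>n\<close> makes the base 1 - \<tau> / N nonnegative, so
    that raising to the power is monotone.\<close>
  have low: "(1 - \<tau> / 2 ^ Suc n) ^ (2 ^ Suc n) \<le> g n (?S f)"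
    if f: "f \<in> bad" and n: "\<tau> \<le> 2 ^ Suc n" for f n
  proof -
    obtain x where x: "P *v x = x" "norm x = 1"
        "x \<bullet> ((\<Sum>t\<in>T. outer (y (f t)) (y (f t))) *v x) \<le> card T * \<mu> / 2"
      using f by (auto simp: bad_def)
    have "x \<bullet> (?S f *v x) = \<theta> * (x \<bullet> ((\<Sum>t\<in>T. outer (y (f t)) (y (f t))) *v x))"
      by (simp add: X_def matvec.scaleR_left flip: scaleR_sum_right)
    also have "\<dots> \<le> \<tau>"
      unfolding \<tau>_def using \<theta> by (intro mult_left_mono x(3)) simp
    finally have S: "x \<bullet> (?S f *v x) \<le> \<tau>" .
    have "x \<bullet> (h n (?S f) *v x) = 1 - (x \<bullet> (?S f *v x)) / 2 ^ Suc n"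
      by (simp add: h_def matvec.diff_left matvec.scaleR_left inner_diff_right x
          power2_norm_eq_inner[symmetric])
    then have "1 - \<tau> / 2 ^ Suc n \<le> x \<bullet> (h n (?S f) *v x)"
      using S by (simp add: divide_right_mono)
    then have "(1 - \<tau> / 2 ^ Suc n) ^ (2 ^ Suc n) \<le> (x \<bullet> (h n (?S f) *v x)) ^ (2 ^ Suc n)"
      using n by (intro power_mono) (auto simp: field_simps)
    also have "\<dots> \<le> g n (?S f)"
      unfolding g_def by (intro trace_pow2_Suc_ge hsym SZ x(2))
    finally show ?thesis .
  qed

  \<comment> \<open>Markov's inequality and the passage to the limit\<close>
  have fin: "finite (PiE T (\<lambda>_. UNIV :: 'i set))" using T by (intro finite_PiE) auto
  let ?B = "\<Sum>f\<in>bad. ?w f"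
  have "?B * (1 - \<tau> / 2 ^ Suc n) ^ (2 ^ Suc n) \<le> a n ^ card T * trace P + e n"
    if "\<tau> \<le> 2 ^ Suc n" for n
  proof -
    have "?B * (1 - \<tau> / 2 ^ Suc n) ^ (2 ^ Suc n) \<le> (\<Sum>f\<in>bad. ?w f * g n (?S f))"
      unfolding sum_distrib_right using p that by (intro sum_mono mult_left_mono low prod_nonneg) auto
    also have "\<dots> \<le> (\<Sum>f\<in>PiE T (\<lambda>_. UNIV). ?w f * g n (?S f))"
      using p by (intro sum_mono2 fin mult_nonneg_nonneg prod_nonneg gnonneg SZ) (auto simp: bad_def)
    finally show ?thesis using e(2)[of n] g0[of n] by simp
  qed
  moreover have "eventually (\<lambda>n. \<tau> \<le> 2 ^ Suc n) sequentially"
  proof -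
    obtain m where m: "\<tau> < 2 ^ m"
      using real_arch_pow[of 2 \<tau>] by auto
    have "\<tau> \<le> 2 ^ Suc n" if "m \<le> n" for n
      using m power_increasing[of m "Suc n" "2::real"] that by linarith
    then show ?thesis
      unfolding eventually_sequentially by blast
  qed
  ultimately have "eventually (\<lambda>n. ?B * (1 - \<tau> / 2 ^ Suc n) ^ (2 ^ Suc n) \<le>
      a n ^ card T * trace P + e n) sequentially"
    by (auto elim: eventually_mono)
  moreover have "(\<lambda>n. ?B * (1 - \<tau> / 2 ^ Suc n) ^ (2 ^ Suc n)) \<longlonglongrightarrow> ?B * exp (- \<tau>)"
    by (intro tendsto_intros power_exp_limit)
  moreover have "(\<lambda>n. a n ^ card T * trace P + e n) \<longlonglongrightarrow> a' ^ card T * trace P + 0"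
    by (intro tendsto_intros alim e)
  ultimately have B: "?B * exp (- \<tau>) \<le> a' ^ card T * trace P"
    using tendsto_le[OF sequentially_bot] by fastforce
  have trP: "0 \<le> trace P"
    using norm_matrix_square[of P] P by (metis zero_le_power2)
  have "a' \<le> exp (- (\<mu> / (2 * R)))"
    using exp_ge_add_one_self[of "- (\<mu> / (2 * R))"] by (simp add: a'_def exp_minus)
  then have "a' ^ card T \<le> exp (- (\<mu> / (2 * R))) ^ card T"
    by (intro power_mono) (auto simp: a'_def)
  also have "\<dots> = exp (- (card T * \<mu> / (2 * R)))"
    by (simp add: exp_of_nat_mult[symmetric])
  finally have "?B * exp (- \<tau>) \<le> exp (- (card T * \<mu> / (2 * R))) * trace P"
    using B trP by (meson mult_right_mono order_trans)
  then have "?B \<le> trace P * exp (\<tau> - card T * \<mu> / (2 * R))"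
    by (simp add: exp_diff exp_minus field_simps)
  \<comment> \<open>The exponent is (ln 2 - 1) q, and ln 2 \<le> 25/36 < 3/4 makes it at most - q /
    4.\<close>
  also have "\<tau> - card T * \<mu> / (2 * R) \<le> - (card T * \<mu> / (8 * R))"
  proof -
    define q where "q = card T * \<mu> / (2 * R)"
    have "\<tau> = ln 2 * q" "card T * \<mu> / (8 * R) = q / 4"
      by (simp_all add: q_def \<tau>_def \<theta>_def)
    moreover have "0 \<le> q"
      using mean(2) y(3) by (simp add: q_def)
    then have "(ln 2 - 3 / 4) * q \<le> 0"
      using ln2_le_25_over_36 by (intro mult_nonpos_nonneg) auto
    ultimately show ?thesis
      unfolding q_def [symmetric] by (simp add: algebra_simps)
  qed
  finally show ?thesis
    using trP by (simp add: mult_left_mono)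
qed

section \<open>The sampling theorem\<close>

text \<open>The event is a finite disjoint union of atoms, on each of which independence factors the
  probability; the analysis thus reduces to weighted sums over functions.\<close>

lemma (in prob_space) prob_indep_finite:
  fixes J :: "'l::finite \<Rightarrow> 'a \<Rightarrow> 'n::finite"
  assumes indep: "indep_vars (\<lambda>_. count_space UNIV) J UNIV"
  shows "prob {\<omega> \<in> space M. (\<lambda>t. J t \<omega>) \<in> B} =
    (\<Sum>f\<in>B. \<Prod>t\<in>UNIV. prob {\<omega> \<in> space M. J t \<omega> = f t})"
proof -
  let ?E = "\<lambda>f. {\<omega> \<in> space M. (\<lambda>t. J t \<omega>) = f}"
  have rv: "J t -` {i} \<inter> space M \<in> events" for t i
    using indep by (auto simp: indep_vars_def intro: measurable_sets)
  have E: "?E f = (\<Inter>t\<in>UNIV. J t -` {f t} \<inter> space M)" for f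
    by (auto simp: fun_eq_iff)
  have "?E f \<in> events" for f
    unfolding E using rv by (intro sets.finite_INT) auto
  then have "prob (\<Union>f\<in>B. ?E f) = (\<Sum>f\<in>B. prob (?E f))"
    by (intro finite_measure_finite_Union) (auto simp: disjoint_family_on_def)
  also have "\<dots> = (\<Sum>f\<in>B. \<Prod>t\<in>UNIV. prob (J t -` {f t} \<inter> space M))"
    unfolding E by (intro sum.cong refl indep_varsD_finite[OF indep]) auto
  also have "(\<Union>f\<in>B. ?E f) = {\<omega> \<in> space M. (\<lambda>t. J t \<omega>) \<in> B}"
    by auto
  finally show ?thesis
    by (simp add: vimage_def Int_def conj_commute)
qed

text \<open>The unit vectors resolve the identity. For the two projections this yields the means P P
  = P and Q P = 0.\<close>

lemma sum_outer_columns: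
  "(\<Sum>i\<in>UNIV. outer (A *v axis i 1) (B *v axis i 1)) = A ** transpose B"
  for A :: "real^'n^'m" and B :: "real^'n^'p"
  by (simp add: outer_def matrix_vector_mult_basis column_def vec_eq_iff matrix_matrix_mult_def
      transpose_def)

lemma sum_Un_le:
  fixes f :: "'a \<Rightarrow> real"
  assumes "finite A" "finite B" "\<And>x. 0 \<le> f x"
  shows "sum f (A \<union> B) \<le> sum f A + sum f B"
  using sum.union_inter[OF assms(1,2), of f] sum_nonneg[of "A \<inter> B" f] assms(3) by simp

text \<open>The diagonal entries of a projection are the squared lengths of its columns. For the
  head this gives total leverage k, for the tail \<rho> - k.\<close>

lemma sum_norm_columns:
  "(\<Sum>i\<in>UNIV. (norm (P *v axis i 1))\<^sup>2) = trace P"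
  if "transpose P = P" "P ** P = P" for P :: "real^'n^'n"
proof -
  have "(norm (P *v axis i 1))\<^sup>2 = P $ i $ i" for i
  proof -
    have "(norm (P *v axis i 1))\<^sup>2 = axis i 1 \<bullet> (P *v axis i 1)"
      by (simp add: power2_norm_eq_inner inner_symmetric_matrix that matrix_vector_mul_assoc)
    then show ?thesis
      by (simp add: matrix_vector_mult_basis column_def inner_axis' )
  qed
  then show ?thesis by (simp add: trace_def)
qed

text \<open>With a = sqrt (v L) and b = R L, the claim becomes 2 a^2 + b (a + b) \<le> 9/4 (a +
  b)^2.\<close>

lemma bernstein_exponent_le:
  fixes v R L r :: real
  assumes v: "0 < v" and R: "0 \<le> R" and L: "0 < L"
    and r: "r = 3 / 2 * (sqrt (v * L) + R * L)"
  shows "L \<le> r\<^sup>2 / (2 * (v + R * r / 3))" "0 < r"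
proof -
  define a where "a = sqrt (v * L)"
  define b where "b = R * L"
  have a: "0 < a" and aa: "a\<^sup>2 = v * L" using v L by (simp_all add: a_def)
  have b: "0 \<le> b" using R L by (simp add: b_def)
  show r0: "0 < r" using a b unfolding r a_def [symmetric] b_def [symmetric] by simp
  have "L * (2 * (v + R * r / 3)) = 2 * a\<^sup>2 + b * (a + b)"
    unfolding aa r a_def [symmetric] by (simp add: b_def algebra_simps)
  also have "\<dots> \<le> 9 / 4 * (a\<^sup>2 + 2 * a * b + b\<^sup>2)"
  proof -
    have "9 / 4 * (a\<^sup>2 + 2 * a * b + b\<^sup>2) - (2 * a\<^sup>2 + b * (a + b)) =
        a\<^sup>2 / 4 + 7 / 2 * (a * b) + 5 / 4 * b\<^sup>2"
      by (simp add: power2_eq_square algebra_simps)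
    moreover have "0 \<le> a\<^sup>2 / 4 + 7 / 2 * (a * b) + 5 / 4 * b\<^sup>2"
      using a b by simp
    ultimately show ?thesis by linarith
  qed
  also have "\<dots> = r\<^sup>2"
    unfolding r a_def [symmetric] b_def [symmetric] by (simp add: power2_eq_square algebra_simps)
  finally show "L \<le> r\<^sup>2 / (2 * (v + R * r / 3))"
    using v R r0 by (simp add: pos_le_divide_eq add_pos_nonneg)
qed

theorem theorem1:
  fixes A :: "real^'n^'m"
    and \<rho> k :: nat
    and \<sigma> :: "nat \<Rightarrow> real" and u :: "nat \<Rightarrow> real^'m" and v :: "nat \<Rightarrow> real^'n"
    and lev s :: "'n \<Rightarrow> real"
    and \<delta> :: real
    and M :: "'w measure"
    and J :: "'l::finite \<Rightarrow> 'w \<Rightarrow> 'n"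
  defines "lev \<equiv> leverage k v"
  assumes rank: "rank A = \<rho>"
    and k: "1 \<le> k" "k < \<rho>"
    and l: "k < CARD('l)"
    and svd: "thin_svd A \<rho> \<sigma> u v"
    and adm: "admissible k lev s"
    and prob: "prob_space M"
    and indep: "prob_space.indep_vars M (\<lambda>_. count_space UNIV) J UNIV"
    and distr: "\<And>t i. measure M {\<omega> \<in> space M. J t \<omega> = i} = s i / real k"
    and \<delta>: "0 < \<delta>" "\<delta> < 1"
  shows "best_rank_approx k A (svd_mat k \<sigma> u v) \<and>
    \<sigma> k = spectral_norm (A - svd_mat k \<sigma> u v) \<and>
    measure M {\<omega> \<in> space M.
        spectral_norm (A - col_proj (col_select A (\<lambda>t. J t \<omega>)) ** A)
          \<le> \<sigma> k * (1 + score_eps k \<rho> CARD('l) \<delta> lev s)}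
      \<ge> 1 - \<delta> - 2 * real k * exp (- (real CARD('l) / (8 * real k * score_c lev s)))"
proof (intro conjI)
  show "best_rank_approx k A (svd_mat k \<sigma> u v)"
    by (rule best_rank_approx_svd[OF svd k(2)])
  show "\<sigma> k = spectral_norm (A - svd_mat k \<sigma> u v)"
    by (rule spectral_norm_tail[OF svd k(2), symmetric])
  interpret prob_space M by (rule prob)

  \<comment> \<open>Projections, leverage scores and importance weights\<close>
  define n where "n = real CARD('l)"
  have n: "0 < n" by (simp add: n_def)
  have k0: "0 < real k" using k by simp
  note orth = uv(2)[OF svd k(2)]
  define P where "P = frame {..<k} v"
  define Q where "Q = frame {k..<\<rho>} v"
  have sub: "{..<k} \<subseteq> {..<\<rho>}" "{k..<\<rho>} \<subseteq> {..<\<rho>}" using k by auto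
  have PP: "P ** P = P" and QQ: "Q ** Q = Q" and QP: "Q ** P = 0"
  proof -
    have "{k..<\<rho>} \<inter> {..<k} = {}" by auto
    then show "P ** P = P" "Q ** Q = Q" "Q ** P = 0"
      unfolding P_def Q_def using frame_mult_frame[OF orth] sub by (simp_all add: frame_def[of "{}"])
  qed
  have Pt: "transpose P = P" and Qt: "transpose Q = Q"
    unfolding P_def Q_def by (rule transpose_frame)+
  have trP: "trace P = k" and trQ: "trace Q = real \<rho> - real k"
    unfolding P_def Q_def using trace_frame[OF orth] sub k by (simp_all add: of_nat_diff)
  define y where "y i = P *v axis i 1" for i
  define w where "w i = Q *v axis i 1" for i
  have lev: "lev i = (norm (y i))\<^sup>2" for i
    unfolding lev_def y_def P_def using leverage_eq_norm[OF orth, of k i] k by simp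

  have s: "0 \<le> s i" "s i = 0 \<Longrightarrow> y i = 0" for i
    using adm lev[of i] unfolding admissible_def by (metis, metis less_irrefl norm_eq_zero zero_less_norm_iff zero_less_power2)
  have s1: "(\<Sum>i\<in>UNIV. s i) = k"
    using adm by (simp add: admissible_def)
  define cs where "cs = score_c lev s"
  define qs where "qs = score_q lev s"
  have cs: "lev i / s i \<le> cs" and qs: "sqrt (lev i) / s i \<le> qs" for i
    unfolding cs_def qs_def score_c_def score_q_def by (auto intro!: Max_ge)
  have lev_le: "lev i \<le> cs * s i" for i
    using cs[of i] s[of i] lev[of i] by (cases "s i = 0") (auto simp: divide_le_eq)
  \<comment> \<open>Summing the bound on the scores gives k \<le> cs k, hence positivity of
    \<open>cs\<close>, needed to divide by it in the exponent.\<close>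
  have "real k = (\<Sum>i\<in>UNIV. lev i)"
    unfolding lev y_def sum_norm_columns[OF Pt PP] trP ..
  also have "\<dots> \<le> (\<Sum>i\<in>UNIV. cs * s i)"
    by (intro sum_mono lev_le)
  also have "\<dots> = cs * k"
    by (simp add: s1 flip: sum_distrib_left)
  finally have cs0: "0 < cs"
    using k0 by (simp add: less_le_trans[OF zero_less_one])
  have qs0: "0 \<le> qs"
    using s(1)[of undefined] lev[of undefined] by (intro order_trans[OF _ qs[of undefined]]) simp

  define p where "p i = s i / k" for i
  define c where "c i = k / (s i * n)" for i
  have p: "0 \<le> p i" "(\<Sum>i\<in>UNIV. p i) = 1" for i
    using s k0 by (simp_all add: p_def s1 flip: sum_divide_distrib)
  have c0: "0 \<le> c i" for i
    using s n by (simp add: c_def)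
  \<comment> \<open>Importance weighting gives p_i c_i = 1 / n. Where s_i = 0 the weight is 0 by the
    division convention, but then y_i = 0 and both sides vanish.\<close>
  have pc: "(p i * c i) *\<^sub>R outer z (y i) = (1 / n) *\<^sub>R outer z (y i)" for i and z :: "real^'n"
    using s(2)[of i] k0 n by (cases "s i = 0") (auto simp: p_def c_def outer_def vec_eq_iff)
  define R1 where "R1 = k * cs / n"
  have R1: "0 < R1" using k0 cs0 n by (simp add: R1_def)
  have clev: "c i * lev i \<le> R1" for i
  proof -
    have "c i * lev i = k * (lev i / s i) / n" by (simp add: c_def)
    also have "\<dots> \<le> R1"
      unfolding R1_def using n k0 by (intro divide_right_mono mult_left_mono cs) auto
    finally show ?thesis .
  qed

  define G where "G f = (\<Sum>t\<in>UNIV. c (f t) *\<^sub>R outer (y (f t)) (y (f t)))" for f :: "'l \<Rightarrow> 'n"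
  define S where "S f = (\<Sum>t\<in>UNIV. c (f t) *\<^sub>R outer (w (f t)) (y (f t)))" for f :: "'l \<Rightarrow> 'n"
  define bad1 where "bad1 = {f. \<exists>x. P *v x = x \<and> norm x = 1 \<and> x \<bullet> (G f *v x) \<le> 1 / 2}"
  define L where "L = ln (\<rho> / \<delta>)"
  define V where "V = R1 * (real \<rho> + 1 - real k)"
  define R2 where "R2 = k * qs / n"
  define r where "r = 3 / 2 * (sqrt (V * L) + R2 * L)"
  define bad2 where "bad2 = {f. r < norm (S f)}"
  let ?pr = "\<lambda>f :: 'l \<Rightarrow> 'n. \<Prod>t\<in>UNIV. p (f t)"
  let ?fail = "exp (- (real CARD('l) / (8 * real k * score_c lev s)))"

  \<comment> \<open>Lower tail of the weighted Gram matrix\<close>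
  have bad1: "(\<Sum>f\<in>bad1. ?pr f) \<le> k * ?fail"
  proof -
    \<comment> \<open>The weight enters as a square root, so that \<open>G f\<close> is a sum of
      outer squares.\<close>
    define y' where "y' i = sqrt (c i) *\<^sub>R y i" for i
    have oy: "outer (y' i) (y' i) = c i *\<^sub>R outer (y i) (y i)" for i
      using c0[of i] by (simp add: y'_def outer_def vec_eq_iff)
    have "(\<Sum>f\<in>{f \<in> PiE UNIV (\<lambda>_. UNIV). \<exists>x. P *v x = x \<and> norm x = 1 \<and>
        x \<bullet> ((\<Sum>t\<in>UNIV. outer (y' (f t)) (y' (f t))) *v x) \<le> CARD('l) * (1 / n) / 2}. ?pr f)
      \<le> trace P * exp (- (CARD('l) * (1 / n) / (8 * R1)))"
    proof (rule matrix_chernoff_lower[OF p Pt PP])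
      show "P *v y' i = y' i" for i
        by (simp add: y'_def y_def matvec.scaleR_right matrix_vector_mul_assoc PP)
      show "(norm (y' i))\<^sup>2 \<le> R1" for i
        using clev[of i] c0[of i] by (simp add: y'_def power_mult_distrib lev)
      \<comment> \<open>Each summand has mean P / n, so over n draws half the mean is the threshold
        1/2 of \<open>bad1\<close>.\<close>
      show "(\<Sum>i\<in>UNIV. p i *\<^sub>R outer (y' i) (y' i)) = (1 / n) *\<^sub>R P"
        unfolding oy scaleR_scaleR pc scaleR_sum_right [symmetric]
        by (simp add: y_def sum_outer_columns Pt PP)
    qed (use R1 n in auto)
    moreover have "1 / (8 * R1) = real CARD('l) / (8 * real k * score_c lev s)"
      using n k0 cs0 by (simp add: R1_def n_def cs_def)
    ultimately show ?thesis
      using n by (simp add: bad1_def G_def oy trP n_def)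
  qed

  have L: "0 < L"
    using k \<delta> by (simp add: L_def)
  have V: "0 < V"
    using R1 k by (simp add: V_def)
  have R2: "0 \<le> R2"
    using k0 qs0 n by (simp add: R2_def)
  have rL: "L \<le> r\<^sup>2 / (2 * (V + R2 * r / 3))" and r0: "0 < r"
    using bernstein_exponent_le[OF V R2 L r_def] by auto
  have wle: "norm (w i) \<le> 1" for i
    using norm_projection_le[OF Qt QQ, of "axis i 1"] by (simp add: w_def)

  \<comment> \<open>Tail of the cross term\<close>
  have bad2: "(\<Sum>f\<in>bad2. ?pr f) \<le> \<delta>"
  proof -
    define X where "X i = c i *\<^sub>R outer (w i) (y i)" for i
    have nX: "(norm (X i))\<^sup>2 = (c i)\<^sup>2 * (norm (w i))\<^sup>2 * lev i" for i
      using c0[of i] by (simp add: X_def norm_outer power_mult_distrib lev)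
    have "(\<Sum>f\<in>{f \<in> PiE UNIV (\<lambda>_. UNIV). r < norm (\<Sum>t\<in>UNIV. X (f t))}. ?pr f)
      \<le> 2 * exp (- r\<^sup>2 / (2 * (V + R2 * r / 3)))"
    proof (rule vector_bernstein[OF p])
      show "(\<Sum>i\<in>UNIV. p i *\<^sub>R X i) = 0"
        unfolding X_def scaleR_scaleR pc scaleR_sum_right [symmetric]
        by (simp add: w_def y_def sum_outer_columns Pt QP)
      show "norm (X i) \<le> R2" for i
      proof -
        have "norm (X i) = c i * norm (w i) * sqrt (lev i)"
          using c0[of i] by (simp add: X_def norm_outer lev)
        also have "\<dots> \<le> c i * 1 * sqrt (lev i)"
          using c0 wle by (intro mult_right_mono mult_left_mono) (auto simp: lev)
        also have "\<dots> = k * (sqrt (lev i) / s i) / n"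
          by (simp add: c_def)
        also have "\<dots> \<le> R2"
          unfolding R2_def using n k0 by (intro divide_right_mono mult_left_mono qs) auto
        finally show ?thesis .
      qed
      \<comment> \<open>As n p_i c_i = 1 for nonzero s_i, one factor c_i of the squared weight
        survives, and c_i times the leverage is at most \<open>R1\<close>.\<close>
      have pX: "n * (p i * (norm (X i))\<^sup>2) \<le> R1 * (norm (w i))\<^sup>2" for i
      proof (cases "s i = 0")
        case False
        then have "n * (p i * (norm (X i))\<^sup>2) = (c i * lev i) * (norm (w i))\<^sup>2"
          unfolding nX p_def c_def using n k0 by (simp add: power2_eq_square)
        also have "\<dots> \<le> R1 * (norm (w i))\<^sup>2"
          by (intro mult_right_mono clev) simp
        finally show ?thesis .
      qed (use R1 in \<open>simp add: p_def\<close>)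
      have "n * (\<Sum>i\<in>UNIV. p i * (norm (X i))\<^sup>2) \<le> (\<Sum>i\<in>UNIV. R1 * (norm (w i))\<^sup>2)"
        unfolding sum_distrib_left by (intro sum_mono pX)
      also have "\<dots> = R1 * (real \<rho> - real k)"
        by (simp add: w_def sum_norm_columns[OF Qt QQ] trQ flip: sum_distrib_left)
      also have "\<dots> \<le> V"
        unfolding V_def using R1 by (intro mult_left_mono) auto
      finally show "real CARD('l) * (\<Sum>i\<in>UNIV. p i * (norm (X i))\<^sup>2) \<le> V"
        by (simp add: n_def)
    qed (use V r0 in auto)
    also have "\<dots> \<le> 2 * exp (- L)"
      using rL by simp
    also have "exp (- L) = \<delta> / \<rho>"
      using k \<delta> by (simp add: L_def exp_minus)
    \<comment> \<open>1 \<le> k < \<rho> forces \<rho> \<ge> 2, which absorbs the prefactor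
      2.\<close>
    also have "2 * (\<delta> / \<rho>) \<le> \<delta>"
      using k \<delta> by (simp add: field_simps)
    finally show ?thesis
      by (simp add: bad2_def S_def X_def)
  qed

  \<comment> \<open>The factor 3 of the error term is the 2 of the residual bound times the 3/2 in
    \<open>r\<close>.\<close>
  have eps: "2 * r = score_eps k \<rho> CARD('l) \<delta> lev s"
    by (simp add: r_def score_eps_def V_def R1_def R2_def L_def n_def cs_def qs_def algebra_simps)
  let ?good = "{f. spectral_norm (A - col_proj (col_select A f) ** A)
    \<le> \<sigma> k * (1 + score_eps k \<rho> CARD('l) \<delta> lev s)}"
  have good: "f \<in> ?good" if f: "f \<notin> bad1" "f \<notin> bad2" for f
  proof -
    \<comment> \<open>\<open>bad1\<close> only speaks of unit vectors; coercivity on the whole range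
      of \<open>P\<close> follows by scaling.\<close>
    have "(norm x)\<^sup>2 / 2 \<le> x \<bullet> (G f *v x)" if x: "P *v x = x" for x
    proof (cases "x = 0")
      case False
      let ?x = "(1 / norm x) *\<^sub>R x"
      have "P *v ?x = ?x" "norm ?x = 1"
        using False by (simp_all add: matvec.scaleR_right x)
      then have "1 / 2 < ?x \<bullet> (G f *v ?x)"
        using f(1) unfolding bad1_def by fastforce
      also have "\<dots> = (x \<bullet> (G f *v x)) / (norm x)\<^sup>2"
        by (simp add: matvec.scaleR_right power2_eq_square)
      finally show ?thesis
        using False by (simp add: field_simps)
    qed simp
    then have "spectral_norm (A - col_proj (col_select A f) ** A) \<le> \<sigma> k * (1 + 2 * norm (S f))"
      using spectral_norm_residual_le[OF svd k(2), of c f]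
      by (simp add: G_def S_def y_def w_def P_def Q_def)
    also have "\<dots> \<le> \<sigma> k * (1 + 2 * r)"
      using f(2) svd k by (intro mult_left_mono) (auto simp: bad2_def thin_svd_def)
    finally show ?thesis by (simp add: eps)
  qed

  \<comment> \<open>Transfer to the probability space and union bound\<close>
  have pr: "0 \<le> ?pr f" for f
    by (intro prod_nonneg p)
  have prob_eq: "prob {\<omega> \<in> space M. (\<lambda>t. J t \<omega>) \<in> B} = (\<Sum>f\<in>B. ?pr f)" for B
    unfolding prob_indep_finite[OF indep] distr p_def ..
  have "1 = (\<Sum>f\<in>UNIV. ?pr f)"
    using prob_eq[of UNIV] by (simp add: prob_space)
  also have "\<dots> \<le> (\<Sum>f\<in>?good \<union> (bad1 \<union> bad2). ?pr f)"
    using good pr by (intro sum_mono2) auto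
  also have "\<dots> \<le> (\<Sum>f\<in>?good. ?pr f) + (\<Sum>f\<in>bad1 \<union> bad2. ?pr f)"
    by (intro sum_Un_le) (auto simp: pr)
  also have "(\<Sum>f\<in>bad1 \<union> bad2. ?pr f) \<le> (\<Sum>f\<in>bad1. ?pr f) + (\<Sum>f\<in>bad2. ?pr f)"
    by (intro sum_Un_le) (auto simp: pr)
  finally have "1 - \<delta> - k * ?fail \<le> (\<Sum>f\<in>?good. ?pr f)"
    using bad1 bad2 by linarith
  moreover have "k * ?fail \<le> 2 * real k * ?fail"
    by simp
  ultimately show "1 - \<delta> - 2 * real k * ?fail \<le> prob {\<omega> \<in> space M.
      spectral_norm (A - col_proj (col_select A (\<lambda>t. J t \<omega>)) ** A)
        \<le> \<sigma> k * (1 + score_eps k \<rho> CARD('l) \<delta> lev s)}"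
    using prob_eq[of ?good] unfolding mem_Collect_eq by linarith
qed

end
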